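(* There is an absolute constant $C>0$ such that the following holds. Let $n\in\mathbb{N}$, $\delta,c\in(0,1]$ with $n\ge C\sqrt{\log\frac{1}{\delta c}}$, let $\mathcal{O}_k:\mathbb{C}^{k\times k}\to\mathbb{C}$ ($1\le k\le n$) be arbitrary oracles, and let $1_k$ be the indicator functions defined in the context. Then either, for every $k\le n$, both (1) $\mathbb{E}_X[1_k(X)]\ge1-\frac{\delta^4c}{64n}$ and (2) $\mathbb{E}_X[1_k(X)\,|\mathcal{O}_k(X)-\mathrm{Per}_k(X)|^2]\le(2nk\delta)^2k!$ hold, or else $\mathsf{PTest}$ (with parameters $n,\delta,c$ and oracle access to $\{\mathcal{O}_k\}$) outputs Reject with probability at least $1-e^{-n}$.
   Context: $\mathrm{Per}_k(X)=\sum_\pi\prod_{i=1}^kx_{i,\pi(i)}$. $\mathbb{E}_X$ is over $X\in\mathbb{C}^{k\times k}$ with i.i.d. standard complex Gaussian entries. $x_{11},\dots,x_{1k}$: first-row entries of $X$; $X_i$: minor deleting first row and $i$-th column. Let $T=\frac{4n}{\delta\sqrt c}$ and $d=\frac{192n^2}{\delta^4c}$. $\mathbb{I}[q]$ is $1$ if $q$ holds and $0$ otherwise. Indicators: $1^{LIN}_1(X)=\mathbb{I}[|\mathcal{O}_1(X)-X|^2\le n^2\delta^2]$; for $2\le k\le n$, $1^{LIN}_k(X)=\mathbb{I}[|\mathcal{O}_k(X)-\sum_ix_{1i}\mathcal{O}_{k-1}(X_i)|^2\le n^2\delta^2k!]$; $1^{TAIL}_k(X)=\mathbb{I}[|\mathcal{O}_k(X)|^2\le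 T^2k!]$; $1^{PERM}_k(X)=\mathbb{I}[|\mathrm{Per}_k(X)|^2\le T^2k!]$; $1_k=1^{LIN}_k\wedge1^{TAIL}_k\wedge1^{PERM}_k$. $\mathsf{LinearityTest}(n,k,\delta)$: sample Gaussian $X\in\mathbb{C}^{k\times k}$; Reject iff $1^{LIN}_k(X)=0$. $\mathsf{TailTest}(k,T)$: sample Gaussian $X$; Reject iff $1^{TAIL}_k(X)=0$. $\mathsf{PTest}$: for each $1\le k\le n$ run $\mathsf{LinearityTest}(n,k,\delta)$ $d$ times and $\mathsf{TailTest}(k,T)$ $d$ times with independent samples; output Accept iff none rejects, otherwise Reject. *)

theory Defs
  imports "HOL-Probability.Probability" "HOL-Combinatorics.Permutations"
begin

text \<open>
  A \<open>k \<times> k\<close> complex matrix is an extensional function on \<open>{1..k} \<times> {1..k}\<close>,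
  i.e. a point of the space of the product measure \<open>gauss_matrix k\<close> below.
\<close>

type_synonym cmatrix = "nat \<times> nat \<Rightarrow> complex"

text \<open>
  The standard complex Gaussian has density \<open>exp (- |z|\<^sup>2) / \<pi>\<close>, so that the expectation of
  \<open>|z|\<^sup>2\<close> is 1.
\<close>

definition complex_gaussian :: "complex measure" where
  "complex_gaussian = density lborel (\<lambda>z. ennreal (exp (- (cmod z)\<^sup>2) / pi))"

definition gauss_matrix :: "nat \<Rightarrow> cmatrix measure" where
  "gauss_matrix k = (\<Pi>\<^sub>M ij \<in> {1..k} \<times> {1..k}. complex_gaussian)"

definition Per :: "nat \<Rightarrow> cmatrix \<Rightarrow> complex" where
  "Per k X = (\<Sum>\<pi> | \<pi> permutes {1..k}. \<Prod>i = 1..k. X (i, \<pi> i))"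

text \<open>The \<open>(k - 1) \<times> (k - 1)\<close> matrix obtained by deleting the first row and the \<open>i\<close>-th column.\<close>

definition row1_minor :: "nat \<Rightarrow> nat \<Rightarrow> cmatrix \<Rightarrow> cmatrix" where
  "row1_minor k i X =
     (\<lambda>(a, b) \<in> {1..k - 1} \<times> {1..k - 1}. X (Suc a, if b < i then b else Suc b))"

definition T_param :: "nat \<Rightarrow> real \<Rightarrow> real \<Rightarrow> real" where
  "T_param n \<delta> c = 4 * real n / (\<delta> * sqrt c)"

definition d_param :: "nat \<Rightarrow> real \<Rightarrow> real \<Rightarrow> real" where
  "d_param n \<delta> c = 192 * (real n)\<^sup>2 / (\<delta> ^ 4 * c)"

text \<open>
  The oracles form a family \<open>\<O>\<close> whose member \<open>\<O> k\<close> is only ever applied to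
  \<open>k \<times> k\<close> matrices.
\<close>

definition LIN :: "nat \<Rightarrow> real \<Rightarrow> (nat \<Rightarrow> cmatrix \<Rightarrow> complex) \<Rightarrow> nat \<Rightarrow> cmatrix \<Rightarrow> bool" where
  "LIN n \<delta> \<O> k X \<longleftrightarrow>
     (if k = 1 then (cmod (\<O> 1 X - X (1, 1)))\<^sup>2 \<le> (real n)\<^sup>2 * \<delta>\<^sup>2
      else (cmod (\<O> k X - (\<Sum>i = 1..k. X (1, i) * \<O> (k - 1) (row1_minor k i X))))\<^sup>2
             \<le> (real n)\<^sup>2 * \<delta>\<^sup>2 * fact k)"

definition TAIL :: "real \<Rightarrow> (nat \<Rightarrow> cmatrix \<Rightarrow> complex) \<Rightarrow> nat \<Rightarrow> cmatrix \<Rightarrow> bool" where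
  "TAIL T \<O> k X \<longleftrightarrow> (cmod (\<O> k X))\<^sup>2 \<le> T\<^sup>2 * fact k"

definition PERM :: "real \<Rightarrow> nat \<Rightarrow> cmatrix \<Rightarrow> bool" where
  "PERM T k X \<longleftrightarrow> (cmod (Per k X))\<^sup>2 \<le> T\<^sup>2 * fact k"

definition ind :: "nat \<Rightarrow> real \<Rightarrow> real \<Rightarrow> (nat \<Rightarrow> cmatrix \<Rightarrow> complex) \<Rightarrow> nat \<Rightarrow> cmatrix \<Rightarrow> real" where
  "ind n \<delta> c \<O> k X =
     of_bool (LIN n \<delta> \<O> k X \<and> TAIL (T_param n \<delta> c) \<O> k X \<and> PERM (T_param n \<delta> c) k X)"

datatype verdict = Accept | Reject

text \<open>The tests as functions of the sampled matrix.\<close>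

definition LinearityTest ::
    "nat \<Rightarrow> nat \<Rightarrow> real \<Rightarrow> (nat \<Rightarrow> cmatrix \<Rightarrow> complex) \<Rightarrow> cmatrix \<Rightarrow> verdict" where
  "LinearityTest n k \<delta> \<O> X = (if LIN n \<delta> \<O> k X then Accept else Reject)"

definition TailTest :: "nat \<Rightarrow> real \<Rightarrow> (nat \<Rightarrow> cmatrix \<Rightarrow> complex) \<Rightarrow> cmatrix \<Rightarrow> verdict" where
  "TailTest k T \<O> X = (if TAIL T \<O> k X then Accept else Reject)"

text \<open>
  The number \<open>d_param n \<delta> c\<close> of repetitions need not be an integer; it is rounded up.
\<close>

definition num_runs :: "nat \<Rightarrow> real \<Rightarrow> real \<Rightarrow> nat" where
  "num_runs n \<delta> c = nat \<lceil>d_param n \<delta> c\<rceil>"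

datatype test_kind = Linearity | Tail

text \<open>
  The joint law of all samples drawn during one execution of the test: the coordinate
  \<open>(t, k, j)\<close> is the \<open>k \<times> k\<close> Gaussian matrix sampled in the \<open>j\<close>-th run of the test of kind \<open>t\<close>
  at level \<open>k\<close>; distinct coordinates are independent.
\<close>

definition PTest_samples ::
    "nat \<Rightarrow> real \<Rightarrow> real \<Rightarrow> (test_kind \<times> nat \<times> nat \<Rightarrow> cmatrix) measure" where
  "PTest_samples n \<delta> c =
     (\<Pi>\<^sub>M (t, k, j) \<in> {Linearity, Tail} \<times> {1..n} \<times> {..<num_runs n \<delta> c}. gauss_matrix k)"

definition PTest ::
    "nat \<Rightarrow> real \<Rightarrow> real \<Rightarrow> (nat \<Rightarrow> cmatrix \<Rightarrow> complex) \<Rightarrow> (test_kind \<times> nat \<times> nat \<Rightarrow> cmatrix) \<Rightarrow> verdict"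
  where
  "PTest n \<delta> c \<O> \<omega> =
     (if \<forall>k\<in>{1..n}. \<forall>j<num_runs n \<delta> c.
           LinearityTest n k \<delta> \<O> (\<omega> (Linearity, k, j)) = Accept \<and>
           TailTest k (T_param n \<delta> c) \<O> (\<omega> (Tail, k, j)) = Accept
      then Accept else Reject)"

end

theory Submission
  imports Defs
begin

text \<open>
  Suppose the test rejects with probability below \<open>1 - e\<^sup>-\<^sup>n\<close>. Then the linearity and tail failure
  probabilities at each level sum to at most \<open>n / d = \<delta>\<^sup>4 c / (192 n)\<close>. The permanent obeys the tail
  bound by Markov's inequality for the fourth moment, \<open>E |Per\<^sub>k|\<^sup>4 \<le> (k + 1) (k!)\<^sup>2\<close>: Wick's formula
  in each row turns the fourth moment into a sum, over the set \<open>S\<close> of rows with the straight pairing,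
  of the number of pairs of permutations with the same image of \<open>S\<close>, that is \<open>k! |S|! (k - |S|)!\<close>.
  This gives (1).

  For (2), induct on \<open>k\<close>. Expanding along the first row, the error at level \<open>k\<close> is the linearity
  defect plus a linear form in the independent first row whose coefficients are the errors on the
  minors. If all minors are good, orthogonality of the row entries adds \<open>n \<delta>\<close> to the normalised
  \<open>L\<^sup>2\<close> error; otherwise the tail bounds give at most \<open>4 T\<^sup>2 k!\<close> on an event of probability
  \<open>k \<delta>\<^sup>4 c / (64 n)\<close>.
\<close>

section \<open>Moments of the complex Gaussian\<close>

text \<open>The moments of a real centred Gaussian of variance 1/2, the law of the real and of the
  imaginary part of a standard complex Gaussian.\<close>

definition normal_moment :: "nat \<Rightarrow> real" where
  "normal_moment p = (if even p then fact p / (2 ^ p * fact (p div 2)) else 0)"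

text \<open>The weight is \<open>normal_density 0 (1 / sqrt 2)\<close>, so the known even and odd
  central moments of the normal law apply.\<close>

lemma has_bochner_integral_normal_moment:
  "has_bochner_integral lborel (\<lambda>x. exp (- x\<^sup>2) / sqrt pi * x ^ p) (normal_moment p)"
proof -
  have d: "normal_density 0 (1 / sqrt 2) x = exp (- x\<^sup>2) / sqrt pi" for x
    by (simp add: normal_density_def power_divide field_simps)
  show ?thesis
  proof (cases "even p")
    case True
    then obtain k where "p = 2 * k" by blast
    with normal_moment_even[of "1 / sqrt 2" 0 k] show ?thesis
      by (simp add: d normal_moment_def power_divide power_mult)
  next
    case False
    then obtain k where "p = 2 * k + 1" by (auto elim: oddE)
    with normal_moment_odd[of "1 / sqrt 2" 0 k] show ?thesis
      by (simp add: d normal_moment_def)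
  qed
qed

text \<open>Lebesgue measure on the plane is the image of a product of two real ones, and the
  Gaussian density splits over \<open>Basis\<close>, which consists of 1 and \<open>\<i>\<close>.
  Real and imaginary part are thus independent, and the moments multiply.\<close>

lemma has_bochner_integral_complex_gaussian_monomial:
  "has_bochner_integral complex_gaussian (\<lambda>z. Re z ^ p * Im z ^ q)
     (normal_moment p * normal_moment q)"
proof -
  interpret product_sigma_finite "\<lambda>_::complex. lborel :: real measure" by standard
  define e where "e b = (if b = (1::complex) then p else q)" for b
  define f where "f b x = exp (- x\<^sup>2) / sqrt pi * x ^ e b" for b and x :: real
  have f: "has_bochner_integral lborel (f b) (normal_moment (e b))" for b
    unfolding f_def by (rule has_bochner_integral_normal_moment)
  have "has_bochner_integral (\<Pi>\<^sub>M b\<in>Basis. lborel) (\<lambda>x. \<Prod>b\<in>Basis. f b (x b))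
          (\<Prod>b\<in>Basis. normal_moment (e b))"
    using f product_integrable_prod[of Basis f] product_integral_prod[of Basis f]
    by (auto simp: has_bochner_integral_iff)
  also have "(\<lambda>x. \<Prod>b\<in>Basis. f b (x b)) =
      (\<lambda>x. (\<lambda>z. \<Prod>b\<in>Basis. f b (z \<bullet> b)) (\<Sum>b\<in>Basis. x b *\<^sub>R b))"
    by (auto intro!: prod.cong simp: inner_sum_left_Basis)
  finally have "has_bochner_integral lborel (\<lambda>z. \<Prod>b\<in>Basis. f b (z \<bullet> b))
       (\<Prod>b\<in>Basis. normal_moment (e b))"
    by (subst lborel_eq, intro has_bochner_integral_distr) (auto simp: f_def)
  also have "(\<lambda>z. \<Prod>b\<in>Basis. f b (z \<bullet> b)) =
      (\<lambda>z. (exp (- (cmod z)\<^sup>2) / pi) *\<^sub>R (Re z ^ p * Im z ^ q))"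
    by (auto simp: Basis_complex_def f_def e_def fun_eq_iff cmod_power2 exp_add[symmetric]
         complex_eq_iff field_simps)
  also have "(\<Prod>b\<in>Basis. normal_moment (e b)) = normal_moment p * normal_moment q"
    by (simp add: Basis_complex_def e_def complex_eq_iff)
  finally show ?thesis
    unfolding complex_gaussian_def
    by (intro has_bochner_integral_density) auto
qed

text \<open>Expand in powers of the real and imaginary part; exchanging \<open>a\<close> and
  \<open>b\<close> is complex conjugation. In a product of two permanents and two conjugated ones,
  an entry occurs at most twice in either form, whence the range of exponents.\<close>

lemma has_bochner_integral_complex_gaussian_moment:
  assumes "a \<le> 2" "b \<le> 2"
  shows "has_bochner_integral complex_gaussian (\<lambda>z. z ^ a * cnj z ^ b) (if a = b then fact a else 0)"
proof -
  note m = has_bochner_integral_of_real[OF has_bochner_integral_complex_gaussian_monomial, where 'a=complex]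
  note mr = has_bochner_integral_bounded_linear[OF bounded_linear_mult_right]
  have nm: "normal_moment 0 = 1" "normal_moment 1 = 0" "normal_moment (Suc 0) = 0" "normal_moment 2 = 1/2" "normal_moment 3 = 0"
    "normal_moment 4 = 3/4"
    by (simp_all add: normal_moment_def fact_numeral)
  have z: "z = of_real (Re z) + \<i> * of_real (Im z)" "cnj z = of_real (Re z) - \<i> * of_real (Im z)" for z
    by (simp_all add: complex_eq_iff)
  have 00: "has_bochner_integral complex_gaussian (\<lambda>z. 1::complex) 1"
    using m[of 0 0] by (simp add: nm)
  have 10: "has_bochner_integral complex_gaussian (\<lambda>z. z) 0"
    using has_bochner_integral_add[OF m[of 1 0] mr[of _ _ _ "\<i>", OF m[of 0 1]]]
    by (simp add: nm z(1)[symmetric])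
  have 11: "has_bochner_integral complex_gaussian (\<lambda>z. z * cnj z) 1"
    using has_bochner_integral_add[OF m[of 2 0] m[of 0 2]]
    by (simp add: nm complex_mult_cnj)
  have 20: "has_bochner_integral complex_gaussian (\<lambda>z. z^2) 0"
    using has_bochner_integral_add[OF has_bochner_integral_diff[OF m[of 2 0] m[of 0 2]]
      mr[of _ _ _ "2*\<i>", OF m[of 1 1]]]
    by (simp add: nm) (subst z(1), simp add: power2_eq_square algebra_simps)
  have 21: "has_bochner_integral complex_gaussian (\<lambda>z. z^2 * cnj z) 0"
    using has_bochner_integral_add[OF has_bochner_integral_add[OF m[of 3 0] m[of 1 2]]
      mr[of _ _ _ "\<i>", OF has_bochner_integral_add[OF m[of 2 1] m[of 0 3]]]]
    by (simp add: nm) (subst z(1), subst z(2), simp add: power2_eq_square power3_eq_cube algebra_simps)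
  \<comment> \<open>With x and y the two parts, this is x^4 + y^4 + 2 x^2 y^2, of expectation 3/4 +
    3/4 + 2/4 = 2.\<close>
  have 22: "has_bochner_integral complex_gaussian (\<lambda>z. z^2 * (cnj z)^2) 2"
    using has_bochner_integral_add[OF has_bochner_integral_add[OF m[of 4 0] m[of 0 4]]
      mr[of _ _ _ "2", OF m[of 2 2]]]
    by (simp add: nm) (subst z(1), subst z(2), simp add: power2_eq_square power4_eq_xxxx algebra_simps)
  note conj = has_bochner_integral_bounded_linear[OF bounded_linear_cnj]
  have 01: "has_bochner_integral complex_gaussian (\<lambda>z. cnj z) 0"
    using conj[OF 10] by simp
  have 02: "has_bochner_integral complex_gaussian (\<lambda>z. cnj z ^ 2) 0"
    using conj[OF 20] by simp
  have 12: "has_bochner_integral complex_gaussian (\<lambda>z. z * cnj z ^ 2) 0"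
    using conj[OF 21] by (simp add: mult.commute)
  have "a = 0 \<or> a = 1 \<or> a = 2" "b = 0 \<or> b = 1 \<or> b = 2" using assms by auto
  then show ?thesis
    using 00 10 20 01 11 21 02 12 22 by (elim disjE) simp_all
qed

section \<open>Counting permutations\<close>

text \<open>Each of the \<open>card I + 1\<close> possible sizes of \<open>S\<close> contributes a
  binomial coefficient times the two factorials, that is \<open>fact (card I)\<close>. This is the
  origin of the factor k + 1 in the fourth moment of the permanent.\<close>

lemma sum_Pow_fact_card:
  assumes "finite I"
  shows "(\<Sum>S\<in>Pow I. fact (card S) * fact (card I - card S) :: nat) = Suc (card I) * fact (card I)"
proof -
  have "(\<Sum>S\<in>Pow I. fact (card S) * fact (card I - card S) :: nat) =
     (\<Sum>s\<in>{..card I}. \<Sum>S | S \<in> Pow I \<and> card S = s. fact (card S) * fact (card I - card S))"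
    using assms by (intro sum.group[symmetric]) (auto intro: card_mono)
  also have "\<dots> = (\<Sum>s\<in>{..card I}. fact (card I))"
    using assms by (intro sum.cong) (auto simp: n_subsets mult.commute[of _ "_ * _"] binomial_fact_lemma)
  finally show ?thesis by simp
qed

text \<open>A permutation that maps \<open>S\<close> onto itself is determined by its restrictions
  to \<open>S\<close> and to the complement, and both restrictions are permutations.\<close>

lemma card_permutes_stabilizing_le:
  assumes "finite I" "S \<subseteq> I"
  shows "card {\<rho>. \<rho> permutes I \<and> \<rho> ` S = S} \<le> fact (card S) * fact (card I - card S)"
proof -
  let ?f = "\<lambda>\<rho>. (restrict_id \<rho> S, restrict_id \<rho> (I - S))"
  have "inj_on ?f {\<rho>. \<rho> permutes I \<and> \<rho> ` S = S}"
  proof (rule inj_onI, rule ext)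
    fix \<rho> \<rho>' x
    assume "\<rho> \<in> {\<rho>. \<rho> permutes I \<and> \<rho> ` S = S}" "\<rho>' \<in> {\<rho>. \<rho> permutes I \<and> \<rho> ` S = S}" and eq: "?f \<rho> = ?f \<rho>'"
    then have p: "\<rho> permutes I" "\<rho>' permutes I" by auto
    have "restrict_id \<rho> S x = restrict_id \<rho>' S x" "restrict_id \<rho> (I - S) x = restrict_id \<rho>' (I - S) x"
      using eq by (auto simp: fun_eq_iff)
    then show "\<rho> x = \<rho>' x"
      by (cases "x \<in> S"; cases "x \<in> I") (auto simp: permutes_not_in[OF p(1)] permutes_not_in[OF p(2)])
  qed
  moreover have "?f ` {\<rho>. \<rho> permutes I \<and> \<rho> ` S = S} \<subseteq> {\<tau>. \<tau> permutes S} \<times> {\<tau>. \<tau> permutes (I - S)}"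
  proof safe
    fix \<rho> assume p: "\<rho> permutes I" and S: "\<rho> ` S = S"
    have inj: "inj \<rho>" using permutes_inj[OF p] .
    show "restrict_id \<rho> S permutes S"
      using inj S by (intro permutes_restrict_id) (auto simp: bij_betw_def intro: inj_on_subset)
    have "\<rho> ` (I - S) = I - S"
      using image_set_diff[OF inj, of I S] S permutes_image[OF p] by simp
    then show "restrict_id \<rho> (I - S) permutes (I - S)"
      using inj by (intro permutes_restrict_id) (auto simp: bij_betw_def intro: inj_on_subset)
  qed
  ultimately have "card {\<rho>. \<rho> permutes I \<and> \<rho> ` S = S} \<le>
       card ({\<tau>. \<tau> permutes S} \<times> {\<tau>. \<tau> permutes (I - S)})"
    using assms by (intro card_inj_on_le[of ?f]) (auto intro: finite_permutations finite_subset)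
  also have "\<dots> = fact (card S) * fact (card I - card S)"
    using assms finite_subset[of S I]
    by (simp add: card_cartesian_product card_permutations[OF refl] card_Diff_subset)
  finally show ?thesis .
qed

text \<open>
  \<open>S\<close> is the set of rows in which \<open>p\<close> is paired with \<open>r\<close> and \<open>q\<close> with \<open>s\<close>; the other rows use the
  crossed pairing.
\<close>

lemma card_swapped_permutations_le:
  fixes I S :: "'a set"
  assumes "finite I" "S \<subseteq> I"
  defines "Q \<equiv> {(p, q, r, s). p permutes I \<and> q permutes I \<and> r permutes I \<and> s permutes I \<and>
      (\<forall>i\<in>S. p i = r i \<and> q i = s i) \<and> (\<forall>i\<in>I - S. p i = s i \<and> q i = r i)}"
  shows "card Q \<le> fact (card I) * (fact (card S) * fact (card I - card S))"
proof -
  let ?P = "{p. p permutes I}"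
  let ?R = "{\<rho>. \<rho> permutes I \<and> \<rho> ` S = S}"
  \<comment> \<open>\<open>p\<close> and \<open>q\<close> determine \<open>r\<close> and
    \<open>s\<close> row by row, and \<open>inv p \<circ> q\<close> keeps the pair injective while
    it stabilizes \<open>S\<close>.\<close>
  let ?f = "\<lambda>(p, q, r, s). (p, inv p \<circ> q) :: ('a \<Rightarrow> 'a) \<times> ('a \<Rightarrow> 'a)"
  have "inj_on ?f Q"
  proof (rule inj_onI)
    fix x y assume "x \<in> Q" "y \<in> Q" and eq: "?f x = ?f y"
    obtain p q r s where x: "x = (p, q, r, s)" by (cases x) auto
    obtain p' q' r' s' where y: "y = (p', q', r', s')" by (cases y) auto
    have p: "p permutes I" "q permutes I" "r permutes I" "s permutes I"
         "p' permutes I" "q' permutes I" "r' permutes I" "s' permutes I"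
      using \<open>x \<in> Q\<close> \<open>y \<in> Q\<close> by (auto simp: Q_def x y)
    have pp: "p' = p" using eq by (simp add: x y)
    have "p \<circ> (inv p \<circ> q) = p \<circ> (inv p \<circ> q')" using eq by (auto simp: x y)
    then have qq: "q' = q"
      using permutes_inv_o[OF p(1)] by (simp add: o_assoc)
    have "r i = r' i \<and> s i = s' i" for i
      using \<open>x \<in> Q\<close> \<open>y \<in> Q\<close> pp qq permutes_not_in[OF p(3)] permutes_not_in[OF p(4)]
         permutes_not_in[OF p(7)] permutes_not_in[OF p(8)]
      unfolding x y Q_def by (cases "i \<in> S"; cases "i \<in> I") force+
    then show "x = y" using pp qq by (auto simp: x y)
  qed
  moreover have "?f ` Q \<subseteq> ?P \<times> ?R"
  proof safe
    fix p q r s assume "(p, q, r, s) \<in> Q"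
    then have p: "p permutes I" "q permutes I" "r permutes I" "s permutes I"
       and S: "\<And>i. i \<in> S \<Longrightarrow> p i = r i" and IS: "\<And>i. i \<in> I - S \<Longrightarrow> q i = r i"
      by (auto simp: Q_def)
    show "p permutes I" by fact
    show "(inv p \<circ> q) permutes I" using p by (intro permutes_compose permutes_inv)
    \<comment> \<open>Since \<open>q\<close> and \<open>r\<close> agree off \<open>S\<close>, taking
      complements shows that they have the same image of \<open>S\<close>; on \<open>S\<close>
      itself \<open>r\<close> agrees with \<open>p\<close>. Hence \<open>q\<close> and
      \<open>p\<close> map \<open>S\<close> to the same set.\<close>
    have "q ` S = q ` (I - (I - S))" using assms(2) by (simp add: double_diff)
    also have "\<dots> = I - q ` (I - S)"
      using image_set_diff[OF permutes_inj[OF p(2)]] permutes_image[OF p(2)] by auto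
    also have "q ` (I - S) = r ` (I - S)" using IS by auto
    also have "I - r ` (I - S) = r ` (I - (I - S))"
      using image_set_diff[OF permutes_inj[OF p(3)]] permutes_image[OF p(3)] by auto
    also have "\<dots> = p ` S" using assms(2) S by (auto simp: double_diff)
    finally have "inv p ` q ` S = S"
      by (simp add: image_inv_f_f permutes_inj[OF p(1)])
    then have *: "(inv p \<circ> q) ` S = S" by (simp only: image_comp)
    show "(inv p \<circ> q) x \<in> S" if "x \<in> S" for x using * that by blast
    show "x \<in> (inv p \<circ> q) ` S" if "x \<in> S" for x using * that by blast
  qed
  moreover have "finite (?P \<times> ?R)"
    using assms by (auto intro: finite_subset[OF _ finite_permutations])
  ultimately have "card Q \<le> card (?P \<times> ?R)"
    by (rule card_inj_on_le)
  also have "\<dots> \<le> fact (card I) * (fact (card S) * fact (card I - card S))"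
    using assms by (simp add: card_cartesian_product card_permutations[OF refl] card_permutes_stabilizing_le)
  finally show "card Q \<le> fact (card I) * (fact (card S) * fact (card I - card S))" .
qed

text \<open>
  The value of \<open>E[x\<^sub>a x\<^sub>b cnj (x\<^sub>c x\<^sub>d)]\<close> for independent standard complex Gaussians; it is 2, not 1,
  when all four indices agree.
\<close>

definition wick :: "'a \<Rightarrow> 'a \<Rightarrow> 'a \<Rightarrow> 'a \<Rightarrow> nat" where
  "wick a b c d = of_bool (a = c \<and> b = d) + of_bool (a = d \<and> b = c)"

text \<open>Each factor \<open>wick\<close> is a sum of two pairings. Multiplying out the product
  over the rows sums over the set \<open>S\<close> of rows that take the first pairing; after
  exchanging the sums, each \<open>S\<close> asks for a count of quadruples of permutations.\<close>

lemma sum_wick_permutations_le: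
  fixes I :: "'a set"
  assumes "finite I"
  shows "(\<Sum>p | p permutes I. \<Sum>q | q permutes I. \<Sum>r | r permutes I. \<Sum>s | s permutes I.
            \<Prod>i\<in>I. wick (p i) (q i) (r i) (s i)) \<le> Suc (card I) * (fact (card I))\<^sup>2"
proof -
  let ?P = "{p. p permutes I}"
  let ?C = "\<lambda>S (p, q, r, s). (\<forall>i\<in>S. p i = r i \<and> q i = s i) \<and> (\<forall>i\<in>I - S. p i = s i \<and> q i = r i)"
  have fP: "finite ?P" using assms by (rule finite_permutations)
  have "(\<Sum>p\<in>?P. \<Sum>q\<in>?P. \<Sum>r\<in>?P. \<Sum>s\<in>?P. \<Prod>i\<in>I. wick (p i) (q i) (r i) (s i)) =
     (\<Sum>(p, q, r, s)\<in>?P \<times> ?P \<times> ?P \<times> ?P. \<Prod>i\<in>I. wick (p i) (q i) (r i) (s i))"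
    by (simp add: sum.cartesian_product)
  also have "\<dots> = (\<Sum>x\<in>?P \<times> ?P \<times> ?P \<times> ?P. \<Sum>S\<in>Pow I. of_bool (?C S x))"
  proof (rule sum.cong)
    fix x :: "('a \<Rightarrow> 'a) \<times> ('a \<Rightarrow> 'a) \<times> ('a \<Rightarrow> 'a) \<times> ('a \<Rightarrow> 'a)"
    obtain p q r s where x: "x = (p, q, r, s)" by (cases x) auto
    have "(\<Prod>i\<in>I. wick (p i) (q i) (r i) (s i)) = (\<Sum>S\<in>Pow I.
       (\<Prod>i\<in>S. of_bool (p i = r i \<and> q i = s i)) * (\<Prod>i\<in>I - S. of_bool (p i = s i \<and> q i = r i)))"
      unfolding wick_def using assms by (rule prod_add)
    also have "\<dots> = (\<Sum>S\<in>Pow I. of_bool (?C S (p, q, r, s)))"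
    proof (intro sum.cong refl)
      fix S assume "S \<in> Pow I"
      have *: "(\<Prod>i\<in>A. of_bool (R i)) = (of_bool (\<forall>i\<in>A. R i) :: nat)" if "finite A" for A and R :: "'a \<Rightarrow> bool"
        using that by induction auto
      show "(\<Prod>i\<in>S. of_bool (p i = r i \<and> q i = s i)) * (\<Prod>i\<in>I - S. of_bool (p i = s i \<and> q i = r i)) =
         (of_bool (?C S (p, q, r, s)) :: nat)"
        using assms \<open>S \<in> Pow I\<close> finite_subset[of S I] by (auto simp: *)
    qed
    finally show "(case x of (p, q, r, s) \<Rightarrow> \<Prod>i\<in>I. wick (p i) (q i) (r i) (s i)) =
        (\<Sum>S\<in>Pow I. of_bool (?C S x))"
      by (simp add: x)
  qed simp
  also have "\<dots> = (\<Sum>S\<in>Pow I. \<Sum>x\<in>?P \<times> ?P \<times> ?P \<times> ?P. of_bool (?C S x))"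
    by (rule sum.swap)
  also have "\<dots> \<le> (\<Sum>S\<in>Pow I. fact (card I) * (fact (card S) * fact (card I - card S)))"
  proof (rule sum_mono)
    fix S assume S: "S \<in> Pow I"
    have "(\<Sum>x\<in>?P \<times> ?P \<times> ?P \<times> ?P. of_bool (?C S x) :: nat) = card ((?P \<times> ?P \<times> ?P \<times> ?P) \<inter> {x. ?C S x})"
      using fP by simp
    also have "(?P \<times> ?P \<times> ?P \<times> ?P) \<inter> {x. ?C S x} =
      {(p, q, r, s). p permutes I \<and> q permutes I \<and> r permutes I \<and> s permutes I \<and>
      (\<forall>i\<in>S. p i = r i \<and> q i = s i) \<and> (\<forall>i\<in>I - S. p i = s i \<and> q i = r i)}"
      by auto
    also have "card \<dots> \<le> fact (card I) * (fact (card S) * fact (card I - card S))"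
      using S assms by (intro card_swapped_permutations_le) auto
    finally show "(\<Sum>x\<in>?P \<times> ?P \<times> ?P \<times> ?P. of_bool (?C S x) :: nat) \<le> fact (card I) * (fact (card S) * fact (card I - card S))" .
  qed
  also have "\<dots> = Suc (card I) * (fact (card I))\<^sup>2"
    unfolding sum_distrib_left[symmetric] sum_Pow_fact_card[OF assms] by (simp add: power2_eq_square algebra_simps)
  finally show ?thesis .
qed

text \<open>\<open>e\<close> and \<open>f\<close> are the exponents of \<open>z\<close> and \<open>cnj z\<close> at entry \<open>j\<close> of a row.\<close>

lemma prod_moments_eq_wick:
  fixes I :: "'a set"
  assumes "finite I" "a \<in> I" "b \<in> I" "c \<in> I" "d \<in> I"
  defines "e \<equiv> \<lambda>j. of_bool (a = j) + of_bool (b = j) :: nat"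
  defines "f \<equiv> \<lambda>j. of_bool (c = j) + of_bool (d = j) :: nat"
  shows "(\<Prod>j\<in>I. if e j = f j then fact (e j) else 0) = (of_nat (wick a b c d) :: complex)"
proof (cases "\<forall>j\<in>I. e j = f j")
  case False
  then have "\<not> (a = c \<and> b = d) \<and> \<not> (a = d \<and> b = c)"
    by (auto simp: e_def f_def)
  then have "wick a b c d = 0" by (simp add: wick_def)
  moreover obtain j where "j \<in> I" "e j \<noteq> f j" using False by blast
  then have "(\<Prod>j\<in>I. if e j = f j then fact (e j) else 0) = (0 :: complex)"
    by (intro prod_zero[OF assms(1)] bexI[of _ j]) auto
  ultimately show ?thesis by simp
next
  case True
  \<comment> \<open>Equal exponents everywhere mean that {a, b} and {c, d} coincide as
    multisets.\<close>
  have 1: "(a = c \<and> b = d) \<or> (a = d \<and> b = c)"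
    using True[rule_format, OF assms(2)] True[rule_format, OF assms(3)] True[rule_format, OF assms(4)]
      True[rule_format, OF assms(5)]
    unfolding e_def f_def
    by (cases "a = b"; cases "c = d"; cases "a = c"; cases "a = d"; cases "b = c"; cases "b = d"; simp)
  \<comment> \<open>An exponent 2 arises only at j = a = b, and its factorial 2 matches the two
    coinciding pairings in \<open>wick\<close>.\<close>
  have "(\<Prod>j\<in>I. if e j = f j then fact (e j) else 0) = (\<Prod>j\<in>I. if j = a \<and> a = b then 2 else 1 :: complex)"
  proof (intro prod.cong refl)
    fix j assume "j \<in> I"
    then have "(if e j = f j then fact (e j) else 0) = (fact (e j) :: complex)" using True by simp
    also have "\<dots> = (if j = a \<and> a = b then 2 else 1)" by (simp add: e_def)
    finally show "(if e j = f j then fact (e j) else 0) = (if j = a \<and> a = b then 2 else 1 :: complex)" .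
  qed
  also have "\<dots> = (if a = b then 2 else 1)"
    using assms by (cases "a = b") simp_all
  also have "\<dots> = of_nat (wick a b c d)"
    using 1 by (auto simp: wick_def)
  finally show ?thesis .
qed

section \<open>Permanents of Gaussian matrices\<close>

text \<open>Laplace expansion along the first row: a permutation of {1..m+1} corresponds to the
  image i of 1 together with a permutation of {1..m}, once row and column labels are closed
  up.\<close>

lemma Per_Suc_expand:
  "Per (Suc m) X = (\<Sum>i = 1..Suc m. X (1, i) * Per m (row1_minor (Suc m) i X))"
proof -
  \<comment> \<open>\<open>sk i\<close> enumerates increasingly the naturals other than
    \<open>i\<close>; it is the column relabelling used by \<open>row1_minor\<close>.\<close>
  define sk where "sk i b = (if b < i then b else Suc b)" for i b :: nat
  define \<Phi> where "\<Phi> = (\<lambda>(i, \<sigma>) x. if x = 1 then i else if x \<in> {2..Suc m} then sk i (\<sigma> (x - 1)) else x)"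
  let ?P = "\<lambda>k. {\<sigma>. \<sigma> permutes {1..k::nat}}"
  have sk_inj: "sk i b = sk i b' \<longleftrightarrow> b = b'" for i b b' by (auto simp: sk_def)
  have sk_ne: "sk i b \<noteq> i" for i b by (auto simp: sk_def)
  have \<Phi>1: "\<Phi> (i, \<sigma>) 1 = i" for i \<sigma> by (simp add: \<Phi>_def)
  have \<Phi>S: "\<Phi> (i, \<sigma>) (Suc a) = sk i (\<sigma> a)" if "a \<in> {1..m}" for i \<sigma> a
    using that by (simp add: \<Phi>_def)
  have perm: "\<Phi> (i, \<sigma>) permutes {1..Suc m}" if i: "i \<in> {1..Suc m}" and \<sigma>: "\<sigma> permutes {1..m}" for i \<sigma>
  proof (rule bij_imp_permutes)
    have sub: "\<Phi> (i, \<sigma>) ` {1..Suc m} \<subseteq> {1..Suc m}"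
    proof
      fix y assume "y \<in> \<Phi> (i, \<sigma>) ` {1..Suc m}"
      then obtain x where x: "x \<in> {1..Suc m}" "y = \<Phi> (i, \<sigma>) x" by auto
      show "y \<in> {1..Suc m}"
      proof (cases "x = 1")
        case True with x i show ?thesis by (simp add: \<Phi>_def)
      next
        case False
        then obtain a where a: "x = Suc a" "a \<in> {1..m}" using x by (cases x) auto
        have "\<sigma> a \<in> {1..m}" using permutes_in_image[OF \<sigma>] a by blast
        then show ?thesis using x a \<Phi>S[of a] by (auto simp: sk_def)
      qed
    qed
    have inj: "inj_on (\<Phi> (i, \<sigma>)) {1..Suc m}"
    proof (rule inj_onI)
      fix x y assume xy: "x \<in> {1..Suc m}" "y \<in> {1..Suc m}" "\<Phi> (i, \<sigma>) x = \<Phi> (i, \<sigma>) y"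
      have *: "x = 1 \<or> (\<exists>a\<in>{1..m}. x = Suc a)" if "x \<in> {1..Suc m}" for x
        using that by (cases x) auto
      consider "x = 1" "y = 1" | b where "x = 1" "b \<in> {1..m}" "y = Suc b"
        | a where "y = 1" "a \<in> {1..m}" "x = Suc a"
        | a b where "a \<in> {1..m}" "x = Suc a" "b \<in> {1..m}" "y = Suc b"
        using *[OF xy(1)] *[OF xy(2)] by blast
      then show "x = y"
      proof cases
        case (2 b) with xy(3) \<Phi>S[of b i \<sigma>] sk_ne[of i "\<sigma> b"] \<Phi>1[of i \<sigma>] show ?thesis by metis
      next
        case (3 a) with xy(3) \<Phi>S[of a i \<sigma>] sk_ne[of i "\<sigma> a"] \<Phi>1[of i \<sigma>] show ?thesis by metis
      next
        case (4 a b)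
        with xy(3) have "\<sigma> a = \<sigma> b" by (simp only: \<Phi>S sk_inj)
        with 4 show ?thesis by (simp add: inj_eq[OF permutes_inj[OF \<sigma>]])
      qed simp
    qed
    then show "bij_betw (\<Phi> (i, \<sigma>)) {1..Suc m} {1..Suc m}"
      using endo_inj_surj[OF _ sub] by (simp add: bij_betw_def)
    show "\<Phi> (i, \<sigma>) x = x" if "x \<notin> {1..Suc m}" for x
      using that by (auto simp: \<Phi>_def)
  qed
  have inj: "inj_on \<Phi> ({1..Suc m} \<times> ?P m)"
  proof (rule inj_onI, clarify)
    fix i \<sigma> i' \<sigma>'
    assume \<sigma>: "\<sigma> permutes {1..m}" "\<sigma>' permutes {1..m}" and eq: "\<Phi> (i, \<sigma>) = \<Phi> (i', \<sigma>')"
    have i: "i = i'" using fun_cong[OF eq, of 1] by (simp add: \<Phi>_def)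
    have "\<sigma> a = \<sigma>' a" for a
      using fun_cong[OF eq, of "Suc a"] \<Phi>S[of a] i permutes_not_in[OF \<sigma>(1), of a]
        permutes_not_in[OF \<sigma>(2), of a]
      by (cases "a \<in> {1..m}") (auto simp: sk_inj)
    with i show "i = i' \<and> \<sigma> = \<sigma>'" by auto
  qed
  \<comment> \<open>Surjectivity comes from counting: the injective image has (m+1) * m! = (m+1)!
    elements.\<close>
  have "\<Phi> ` ({1..Suc m} \<times> ?P m) = ?P (Suc m)"
  proof (rule card_subset_eq)
    show "card (\<Phi> ` ({1..Suc m} \<times> ?P m)) = card (?P (Suc m))"
      by (subst card_image[OF inj])
        (simp add: card_cartesian_product card_permutations[where n="Suc m"] card_permutations[where n=m])
  qed (use perm in \<open>auto intro: finite_permutations\<close>)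
  with inj have bij: "bij_betw \<Phi> ({1..Suc m} \<times> ?P m) (?P (Suc m))"
    by (simp add: bij_betw_def)
  have "Per (Suc m) X = (\<Sum>x\<in>{1..Suc m} \<times> ?P m. \<Prod>a = 1..Suc m. X (a, \<Phi> x a))"
    unfolding Per_def by (rule sum.reindex_bij_betw[OF bij, symmetric])
  also have "\<dots> = (\<Sum>(i, \<sigma>)\<in>{1..Suc m} \<times> ?P m. X (1, i) * (\<Prod>a = 1..m. row1_minor (Suc m) i X (a, \<sigma> a)))"
  proof (intro sum.cong refl, clarify)
    fix i \<sigma> assume \<sigma>: "\<sigma> permutes {1..m}"
    have "(\<Prod>a = 1..Suc m. X (a, \<Phi> (i, \<sigma>) a)) = X (1, i) * (\<Prod>a = 1..m. X (Suc a, \<Phi> (i, \<sigma>) (Suc a)))"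
      using prod.atLeast_Suc_atMost[of 1 "Suc m" "\<lambda>a. X (a, \<Phi> (i, \<sigma>) a)"]
        prod.atLeast_Suc_atMost_Suc_shift[of "\<lambda>a. X (a, \<Phi> (i, \<sigma>) a)" 1 m] \<Phi>1[of i \<sigma>]
      by simp
    also have "(\<Prod>a = 1..m. X (Suc a, \<Phi> (i, \<sigma>) (Suc a))) = (\<Prod>a = 1..m. row1_minor (Suc m) i X (a, \<sigma> a))"
    proof (intro prod.cong refl)
      fix a assume a: "a \<in> {1..m}"
      have "\<sigma> a \<in> {1..m}" using permutes_in_image[OF \<sigma>] a by blast
      with a show "X (Suc a, \<Phi> (i, \<sigma>) (Suc a)) = row1_minor (Suc m) i X (a, \<sigma> a)"
        by (simp add: \<Phi>S row1_minor_def sk_def)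
    qed
    finally show "(\<Prod>a = 1..Suc m. X (a, \<Phi> (i, \<sigma>) a)) = X (1, i) * (\<Prod>a = 1..m. row1_minor (Suc m) i X (a, \<sigma> a))" .
  qed
  also have "\<dots> = (\<Sum>i = 1..Suc m. X (1, i) * Per m (row1_minor (Suc m) i X))"
    by (simp add: Per_def sum.cartesian_product[symmetric] sum_distrib_left)
  finally show ?thesis .
qed

section \<open>Moments of Gaussian matrices and the fourth moment of the permanent\<close>

lemma sets_complex_gaussian [measurable_cong]: "sets complex_gaussian = sets borel"
  by (simp add: complex_gaussian_def)

lemma prob_space_complex_gaussian: "prob_space complex_gaussian"
proof
  have 1: "has_bochner_integral complex_gaussian (\<lambda>_. 1 :: complex) 1"
    using has_bochner_integral_complex_gaussian_moment[of 0 0] by simp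
  then have "measure complex_gaussian (space complex_gaussian) = 1"
    by (simp add: has_bochner_integral_iff scaleR_conv_of_real)
  \<comment> \<open>An infinite total mass would make \<open>measure\<close> equal to 0, which
    contradicts the value 1 just obtained.\<close>
  then show "emeasure complex_gaussian (space complex_gaussian) = 1"
    by (cases "emeasure complex_gaussian (space complex_gaussian) = \<infinity>")
      (simp_all add: measure_def emeasure_eq_ennreal_measure)
qed

lemma prob_space_gauss_matrix: "prob_space (gauss_matrix k)"
  unfolding gauss_matrix_def by (intro prob_space_PiM prob_space_complex_gaussian)

text \<open>By independence, the expectation of a monomial is the product of the one-variable
  moments. Such a moment vanishes unless an entry and its conjugate have equal exponents.\<close>

lemma has_bochner_integral_PiM_gaussian_monomial:
  assumes J: "finite J" and "\<And>x. x \<in> J \<Longrightarrow> e x \<le> 2 \<and> f x \<le> 2"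
  shows "has_bochner_integral (\<Pi>\<^sub>M x\<in>J. complex_gaussian) (\<lambda>X. \<Prod>x\<in>J. X x ^ e x * cnj (X x) ^ f x)
     (\<Prod>x\<in>J. if e x = f x then fact (e x) else 0)"
proof -
  interpret prob_space complex_gaussian by (rule prob_space_complex_gaussian)
  interpret product_sigma_finite "\<lambda>_. complex_gaussian" by standard
  let ?g = "\<lambda>x z. z ^ e x * cnj z ^ f x"
  have m: "has_bochner_integral complex_gaussian (?g x) (if e x = f x then fact (e x) else 0)"
    if "x \<in> J" for x
    using assms(2)[OF that] by (intro has_bochner_integral_complex_gaussian_moment) auto
  then have i: "\<And>x. x \<in> J \<Longrightarrow> integrable complex_gaussian (?g x)"
    by (auto simp: has_bochner_integral_iff)
  have "(\<integral>X. (\<Prod>x\<in>J. ?g x (X x)) \<partial>(\<Pi>\<^sub>M x\<in>J. complex_gaussian)) = (\<Prod>x\<in>J. integral\<^sup>L complex_gaussian (?g x))"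
    using J i by (rule product_integral_prod)
  also have "\<dots> = (\<Prod>x\<in>J. if e x = f x then fact (e x) else 0)"
    by (intro prod.cong refl has_bochner_integral_integral_eq[OF m])
  finally show ?thesis
    using product_integrable_prod[OF J i] by (auto simp: has_bochner_integral_iff)
qed

text \<open>Writes a single entry as a product over all indices, so that products of chosen entries
  become monomials in all entries.\<close>

lemma prod_power_of_bool:
  fixes g :: "'a \<Rightarrow> 'b::comm_semiring_1"
  assumes "finite J" "a \<in> J"
  shows "(\<Prod>j\<in>J. g j ^ of_bool (a = j)) = g a"
proof -
  have "(\<Prod>j\<in>J. g j ^ of_bool (a = j)) = (\<Prod>j\<in>J. if a = j then g j else 1)"
    by (intro prod.cong) auto
  with assms show ?thesis by simp
qed

text \<open>Let \<open>e\<close> and \<open>f\<close> count how many of \<open>p\<close>,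
  \<open>q\<close> and how many of \<open>r\<close>, \<open>s\<close> send i to j. The integrand is
  then a monomial with these exponents, and the factors of row i multiply to its \<open>wick\<close>
  value.\<close>

lemma has_bochner_integral_wick:
  assumes p: "p permutes {1..k}" "q permutes {1..k}" "r permutes {1..k}" "s permutes {1..k}"
  shows "has_bochner_integral (gauss_matrix k)
     (\<lambda>X. \<Prod>i = 1..k. X (i, p i) * X (i, q i) * (cnj (X (i, r i)) * cnj (X (i, s i))))
     (of_nat (\<Prod>i = 1..k. wick (p i) (q i) (r i) (s i)))"
proof -
  let ?I = "{1..k}"
  define e where "e = (\<lambda>(i, j). of_bool (p i = j) + of_bool (q i = j) :: nat)"
  define f where "f = (\<lambda>(i, j). of_bool (r i = j) + of_bool (s i = j) :: nat)"
  have in_I: "t i \<in> ?I" if "t permutes ?I" "i \<in> ?I" for t i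
    using permutes_in_image[OF that(1)] that(2) by blast
  have "(\<Prod>x\<in>?I \<times> ?I. X x ^ e x * cnj (X x) ^ f x) =
     (\<Prod>i\<in>?I. X (i, p i) * X (i, q i) * (cnj (X (i, r i)) * cnj (X (i, s i))))" for X
  proof -
    have "(\<Prod>x\<in>?I \<times> ?I. X x ^ e x * cnj (X x) ^ f x) =
        (\<Prod>i\<in>?I. \<Prod>j\<in>?I. X (i, j) ^ e (i, j) * cnj (X (i, j)) ^ f (i, j))"
      unfolding prod.cartesian_product by (intro prod.cong) auto
    also have "\<dots> = (\<Prod>i\<in>?I. X (i, p i) * X (i, q i) * (cnj (X (i, r i)) * cnj (X (i, s i))))"
      using in_I[OF p(1)] in_I[OF p(2)] in_I[OF p(3)] in_I[OF p(4)]
      by (intro prod.cong refl) (simp only: e_def f_def split power_add prod.distrib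
          prod_power_of_bool finite_atLeastAtMost)
    finally show ?thesis .
  qed
  moreover have "(\<Prod>x\<in>?I \<times> ?I. if e x = f x then fact (e x) else 0) =
      (of_nat (\<Prod>i\<in>?I. wick (p i) (q i) (r i) (s i)) :: complex)"
  proof -
    have "(\<Prod>x\<in>?I \<times> ?I. if e x = f x then fact (e x) else 0) =
      (\<Prod>i\<in>?I. \<Prod>j\<in>?I. if e (i, j) = f (i, j) then fact (e (i, j)) else 0 :: complex)"
      unfolding prod.cartesian_product by (intro prod.cong) auto
    also have "\<dots> = (\<Prod>i\<in>?I. of_nat (wick (p i) (q i) (r i) (s i)))"
    proof (intro prod.cong refl)
      fix i assume "i \<in> ?I"
      then show "(\<Prod>j\<in>?I. if e (i, j) = f (i, j) then fact (e (i, j)) else 0 :: complex) =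
          of_nat (wick (p i) (q i) (r i) (s i))"
        using prod_moments_eq_wick[of ?I "p i" "q i" "r i" "s i"] in_I[OF p(1)] in_I[OF p(2)]
          in_I[OF p(3)] in_I[OF p(4)]
        by (simp only: e_def f_def split finite_atLeastAtMost)
    qed
    finally show ?thesis by simp
  qed
  ultimately show ?thesis
    using has_bochner_integral_PiM_gaussian_monomial[of "?I \<times> ?I" e f]
    by (simp add: e_def f_def split_beta gauss_matrix_def)
qed

text \<open>The fourth power is the product of two permanents and two conjugated ones, a sum over
  quadruples of permutations to which Wick's formula applies term by term. The value
  \<open>B\<close> is obtained together with integrability, as Markov's inequality requires
  both.\<close>

lemma Per_fourth_moment_le:
  obtains B where "has_bochner_integral (gauss_matrix k) (\<lambda>X. cmod (Per k X) ^ 4) B"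
    "B \<le> real (Suc k) * (fact k)\<^sup>2"
proof -
  let ?P = "{p. p permutes {1..k}}"
  let ?N = "\<Sum>p\<in>?P. \<Sum>q\<in>?P. \<Sum>r\<in>?P. \<Sum>s\<in>?P. \<Prod>i = 1..k. wick (p i) (q i) (r i) (s i)"
  have expand: "(\<Sum>p\<in>?P. \<Sum>q\<in>?P. \<Sum>r\<in>?P. \<Sum>s\<in>?P.
        \<Prod>i = 1..k. X (i, p i) * X (i, q i) * (cnj (X (i, r i)) * cnj (X (i, s i)))) =
      complex_of_real (cmod (Per k X) ^ 4)" for X
  proof -
    have "(\<Sum>p\<in>?P. \<Sum>q\<in>?P. \<Sum>r\<in>?P. \<Sum>s\<in>?P.
        \<Prod>i = 1..k. X (i, p i) * X (i, q i) * (cnj (X (i, r i)) * cnj (X (i, s i)))) =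
       Per k X * Per k X * (cnj (Per k X) * cnj (Per k X))"
      unfolding prod.distrib Per_def
      by (simp only: sum_distrib_left[symmetric] sum_distrib_right[symmetric] cnj_sum cnj_prod)
    also have "\<dots> = (Per k X * cnj (Per k X))\<^sup>2"
      by (simp add: power2_eq_square)
    also have "\<dots> = complex_of_real (cmod (Per k X) ^ 4)"
      unfolding complex_norm_square[symmetric] by (simp flip: power_mult)
    finally show ?thesis .
  qed
  have "has_bochner_integral (gauss_matrix k) (\<lambda>X. \<Sum>p\<in>?P. \<Sum>q\<in>?P. \<Sum>r\<in>?P. \<Sum>s\<in>?P.
        \<Prod>i = 1..k. X (i, p i) * X (i, q i) * (cnj (X (i, r i)) * cnj (X (i, s i))))
       (\<Sum>p\<in>?P. \<Sum>q\<in>?P. \<Sum>r\<in>?P. \<Sum>s\<in>?P. of_nat (\<Prod>i = 1..k. wick (p i) (q i) (r i) (s i)))"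
    by (intro has_bochner_integral_sum has_bochner_integral_wick) auto
  then have "has_bochner_integral (gauss_matrix k) (\<lambda>X. complex_of_real (cmod (Per k X) ^ 4)) (of_nat ?N)"
    by (simp only: expand of_nat_sum)
  from has_bochner_integral_bounded_linear[OF bounded_linear_Re this]
  have int: "has_bochner_integral (gauss_matrix k) (\<lambda>X. cmod (Per k X) ^ 4) (real ?N)"
    by (simp only: Re_complex_of_real complex_Re_of_nat)
  have "real ?N \<le> real (Suc k * (fact k)\<^sup>2)"
    using sum_wick_permutations_le[of "{1..k}"] by (simp only: of_nat_le_iff finite_atLeastAtMost card_atLeastAtMost diff_Suc_1)
  then have "real ?N \<le> real (Suc k) * (fact k)\<^sup>2"
    by (simp only: of_nat_mult of_nat_power of_nat_fact)
  with int show thesis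
    by (rule that)
qed

section \<open>Minors of Gaussian matrices and expansion along the first row\<close>

lemma measurable_gauss_entry:
  assumes "x \<in> {1..k} \<times> {1..k}"
  shows "(\<lambda>X. X x) \<in> borel_measurable (gauss_matrix k)"
proof -
  have "(\<lambda>X. X x) \<in> gauss_matrix k \<rightarrow>\<^sub>M complex_gaussian"
    using assms unfolding gauss_matrix_def by (rule measurable_component_singleton)
  then show ?thesis by (simp cong: measurable_cong_sets add: sets_complex_gaussian)
qed

lemma measurable_Per [measurable]: "Per k \<in> borel_measurable (gauss_matrix k)"
proof -
  have "(\<lambda>X. X (i, \<pi> i)) \<in> borel_measurable (gauss_matrix k)" if "\<pi> permutes {1..k}" "i \<in> {1..k}" for \<pi> i
    using that permutes_in_image[OF that(1)] by (intro measurable_gauss_entry) auto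
  then show ?thesis
    unfolding Per_def[abs_def] by (intro borel_measurable_sum borel_measurable_prod) auto
qed

text \<open>A minor selects entries along an injective map of indices, so its entries are again
  independent Gaussians. Only rows from 2 on are read; the index set \<open>K\<close> is left
  general to cover both the whole matrix and the matrix without its first row.\<close>

lemma
  assumes i: "i \<in> {1..Suc m}" and K: "{2..Suc m} \<times> {1..Suc m} \<subseteq> K"
  shows measurable_row1_minor_PiM:
      "row1_minor (Suc m) i \<in> (\<Pi>\<^sub>M x\<in>K. complex_gaussian) \<rightarrow>\<^sub>M gauss_matrix m"
    and distr_row1_minor_PiM:
      "distr (\<Pi>\<^sub>M x\<in>K. complex_gaussian) (gauss_matrix m) (row1_minor (Suc m) i) = gauss_matrix m"
proof -
  let ?f = "\<lambda>(a, b). (Suc a, if b < i then b else Suc b)"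
  let ?I = "{1..m} \<times> {1..m}"
  have f: "?f \<in> ?I \<rightarrow> K" using K i by (force simp: subset_eq)
  have minor: "row1_minor (Suc m) i = (\<lambda>X. \<lambda>x\<in>?I. X (?f x))"
    by (auto simp: row1_minor_def fun_eq_iff)
  show "row1_minor (Suc m) i \<in> (\<Pi>\<^sub>M x\<in>K. complex_gaussian) \<rightarrow>\<^sub>M gauss_matrix m"
    unfolding minor gauss_matrix_def
    by (intro measurable_restrict measurable_component_singleton funcset_mem[OF f])
  show "distr (\<Pi>\<^sub>M x\<in>K. complex_gaussian) (gauss_matrix m) (row1_minor (Suc m) i) = gauss_matrix m"
    unfolding minor gauss_matrix_def
    by (rule distr_PiM_reindex[OF prob_space_complex_gaussian _ f])
      (auto simp: inj_on_def split: if_splits)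
qed

lemma
  assumes "i \<in> {1..Suc m}"
  shows measurable_row1_minor: "row1_minor (Suc m) i \<in> gauss_matrix (Suc m) \<rightarrow>\<^sub>M gauss_matrix m"
    and distr_row1_minor:
      "distr (gauss_matrix (Suc m)) (gauss_matrix m) (row1_minor (Suc m) i) = gauss_matrix m"
proof -
  have "{2..Suc m} \<times> {1..Suc m} \<subseteq> {1..Suc m} \<times> {1..Suc m}" by auto
  from measurable_row1_minor_PiM[OF assms this] distr_row1_minor_PiM[OF assms this]
  show "row1_minor (Suc m) i \<in> gauss_matrix (Suc m) \<rightarrow>\<^sub>M gauss_matrix m"
    "distr (gauss_matrix (Suc m)) (gauss_matrix m) (row1_minor (Suc m) i) = gauss_matrix m"
    unfolding gauss_matrix_def[of "Suc m"] .
qed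

text \<open>Independent standard complex Gaussians are orthonormal: E[y_j cnj y_l] is 1 for j = l
  and 0 otherwise, so the cross terms of the expanded square vanish.\<close>

lemma nn_integral_gaussian_linear_form:
  fixes c :: "'a \<Rightarrow> complex"
  assumes J: "finite J"
  shows "(\<integral>\<^sup>+y. ennreal ((cmod (\<Sum>j\<in>J. y j * c j))\<^sup>2) \<partial>(\<Pi>\<^sub>M x\<in>J. complex_gaussian)) =
    ennreal (\<Sum>j\<in>J. (cmod (c j))\<^sup>2)"
proof -
  let ?M = "\<Pi>\<^sub>M x\<in>J. complex_gaussian"
  have cov: "has_bochner_integral ?M (\<lambda>y. y j * cnj (y l)) (of_bool (j = l))"
    if jl: "j \<in> J" "l \<in> J" for j l
  proof -
    have "(\<Prod>x\<in>J. y x ^ of_bool (j = x) * cnj (y x) ^ of_bool (l = x)) = y j * cnj (y l)" for y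
      using J jl by (simp only: prod.distrib prod_power_of_bool)
    moreover have "(\<Prod>x\<in>J. if of_bool (j = x) = (of_bool (l = x) :: nat) then fact (of_bool (j = x)) else 0) =
        (of_bool (j = l) :: complex)"
    proof (cases "j = l")
      case False
      with J jl show ?thesis by (auto intro!: prod_zero bexI[of _ j])
    qed (auto intro!: prod.neutral)
    ultimately show ?thesis
      using has_bochner_integral_PiM_gaussian_monomial[OF J, of "\<lambda>x. of_bool (j = x)" "\<lambda>x. of_bool (l = x)"]
      by simp
  qed
  have "has_bochner_integral ?M (\<lambda>y. \<Sum>j\<in>J. \<Sum>l\<in>J. (c j * cnj (c l)) * (y j * cnj (y l)))
      (\<Sum>j\<in>J. \<Sum>l\<in>J. (c j * cnj (c l)) * of_bool (j = l))"
    by (intro has_bochner_integral_sum has_bochner_integral_mult_right cov)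
  also have "(\<lambda>y. \<Sum>j\<in>J. \<Sum>l\<in>J. (c j * cnj (c l)) * (y j * cnj (y l))) =
      (\<lambda>y. complex_of_real ((cmod (\<Sum>j\<in>J. y j * c j))\<^sup>2))"
    unfolding complex_norm_square cnj_sum sum_product by (simp add: mult_ac)
  also have "(\<Sum>j\<in>J. \<Sum>l\<in>J. (c j * cnj (c l)) * of_bool (j = l)) =
      complex_of_real (\<Sum>j\<in>J. (cmod (c j))\<^sup>2)"
  proof -
    have "(\<Sum>l\<in>J. (c j * cnj (c l)) * of_bool (j = l)) = complex_of_real ((cmod (c j))\<^sup>2)" if "j \<in> J" for j
    proof -
      have "(\<Sum>l\<in>J. (c j * cnj (c l)) * of_bool (j = l)) = (\<Sum>l\<in>J. if j = l then c j * cnj (c l) else 0)"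
        by (intro sum.cong) auto
      with J that show ?thesis by (simp only: complex_norm_square sum.delta' if_True)
    qed
    then show ?thesis by simp
  qed
  finally have "has_bochner_integral ?M (\<lambda>y. complex_of_real ((cmod (\<Sum>j\<in>J. y j * c j))\<^sup>2))
      (complex_of_real (\<Sum>j\<in>J. (cmod (c j))\<^sup>2))" .
  from has_bochner_integral_bounded_linear[OF bounded_linear_Re this]
  have "has_bochner_integral ?M (\<lambda>y. (cmod (\<Sum>j\<in>J. y j * c j))\<^sup>2) (\<Sum>j\<in>J. (cmod (c j))\<^sup>2)"
    by (simp only: Re_complex_of_real)
  then show ?thesis
    by (subst nn_integral_eq_integral) (auto simp: has_bochner_integral_iff)
qed

text \<open>Integrate over the first row \<open>?J\<close> with the lower rows \<open>?I\<close>
  held fixed: the minors are then constants, and the sum is a linear form in the first row. Each of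
  the m+1 squared coefficients left over is a function of a Gaussian minor.\<close>

lemma nn_integral_row_expansion:
  assumes [measurable]: "g \<in> borel_measurable (gauss_matrix m)"
  shows "(\<integral>\<^sup>+X. ennreal ((cmod (\<Sum>i = 1..Suc m. X (1, i) * g (row1_minor (Suc m) i X)))\<^sup>2) \<partial>gauss_matrix (Suc m)) =
    of_nat (Suc m) * (\<integral>\<^sup>+Y. ennreal ((cmod (g Y))\<^sup>2) \<partial>gauss_matrix m)"
proof -
  interpret prob_space complex_gaussian by (rule prob_space_complex_gaussian)
  interpret product_sigma_finite "\<lambda>_::nat \<times> nat. complex_gaussian" by standard
  let ?I = "{2..Suc m} \<times> {1..Suc m}"
  let ?J = "{1::nat} \<times> {1..Suc m}"
  let ?F = "\<lambda>X. ennreal ((cmod (\<Sum>i = 1..Suc m. X (1, i) * g (row1_minor (Suc m) i X)))\<^sup>2)"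
  have IJ: "{1..Suc m} \<times> {1..Suc m} = ?I \<union> ?J" by auto
  have F: "?F \<in> borel_measurable (gauss_matrix (Suc m))"
  proof -
    have "(\<lambda>X. X (1, i) * g (row1_minor (Suc m) i X)) \<in> borel_measurable (gauss_matrix (Suc m))"
      if "i \<in> {1..Suc m}" for i
      using that measurable_compose[OF measurable_row1_minor[OF that] assms]
      by (intro borel_measurable_times measurable_gauss_entry) auto
    then have "(\<lambda>X. \<Sum>i = 1..Suc m. X (1, i) * g (row1_minor (Suc m) i X)) \<in> borel_measurable (gauss_matrix (Suc m))"
      by (rule borel_measurable_sum)
    then show ?thesis by measurable
  qed
  have "integral\<^sup>N (gauss_matrix (Suc m)) ?F =
      (\<integral>\<^sup>+x. (\<integral>\<^sup>+y. ?F (merge ?I ?J (x, y)) \<partial>(\<Pi>\<^sub>M x\<in>?J. complex_gaussian)) \<partial>(\<Pi>\<^sub>M x\<in>?I. complex_gaussian))"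
    using F unfolding gauss_matrix_def IJ by (intro product_nn_integral_fold) auto
  also have "\<dots> = (\<integral>\<^sup>+x. (\<Sum>i = 1..Suc m. ennreal ((cmod (g (row1_minor (Suc m) i x)))\<^sup>2)) \<partial>(\<Pi>\<^sub>M x\<in>?I. complex_gaussian))"
  proof (rule nn_integral_cong)
    fix x
    define c where "c = (\<lambda>(j::nat, i). g (row1_minor (Suc m) i x))"
    have "row1_minor (Suc m) i (merge ?I ?J (x, y)) = row1_minor (Suc m) i x" if "i \<in> {1..Suc m}" for i y
      using that by (auto simp: row1_minor_def fun_eq_iff merge_def)
    moreover have "merge ?I ?J (x, y) (1, i) = y (1, i)" if "i \<in> {1..Suc m}" for i y
      using that by (auto simp: merge_def)
    ultimately have "(\<Sum>i = 1..Suc m. merge ?I ?J (x, y) (1, i) * g (row1_minor (Suc m) i (merge ?I ?J (x, y)))) =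
        (\<Sum>j\<in>?J. y j * c j)" for y
      by (intro sum.reindex_bij_witness[of _ snd "Pair 1"]) (auto simp: c_def)
    then have "(\<integral>\<^sup>+y. ?F (merge ?I ?J (x, y)) \<partial>(\<Pi>\<^sub>M x\<in>?J. complex_gaussian)) = ennreal (\<Sum>j\<in>?J. (cmod (c j))\<^sup>2)"
      by (simp only: nn_integral_gaussian_linear_form finite_cartesian_product finite_atLeastAtMost finite.intros)
    also have "(\<Sum>j\<in>?J. (cmod (c j))\<^sup>2) = (\<Sum>i = 1..Suc m. (cmod (g (row1_minor (Suc m) i x)))\<^sup>2)"
      by (rule sum.reindex_bij_witness[of _ "Pair 1" snd]) (auto simp: c_def)
    finally show "(\<integral>\<^sup>+y. ?F (merge ?I ?J (x, y)) \<partial>(\<Pi>\<^sub>M x\<in>?J. complex_gaussian)) =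
        (\<Sum>i = 1..Suc m. ennreal ((cmod (g (row1_minor (Suc m) i x)))\<^sup>2))"
      by (simp only: sum_ennreal zero_le_power2)
  qed
  also have "\<dots> = (\<Sum>i = 1..Suc m. \<integral>\<^sup>+x. ennreal ((cmod (g (row1_minor (Suc m) i x)))\<^sup>2) \<partial>(\<Pi>\<^sub>M x\<in>?I. complex_gaussian))"
  proof (rule nn_integral_sum)
    have "(\<lambda>Y. ennreal ((cmod (g Y))\<^sup>2)) \<in> borel_measurable (gauss_matrix m)" by measurable
    from measurable_compose[OF measurable_row1_minor_PiM[OF _ order_refl] this]
    show "\<And>i. i \<in> {1..Suc m} \<Longrightarrow> (\<lambda>x. ennreal ((cmod (g (row1_minor (Suc m) i x)))\<^sup>2)) \<in>
        borel_measurable (\<Pi>\<^sub>M x\<in>?I. complex_gaussian)" .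
  qed
  also have "\<dots> = (\<Sum>i = 1..Suc m. \<integral>\<^sup>+Y. ennreal ((cmod (g Y))\<^sup>2) \<partial>gauss_matrix m)"
  proof (intro sum.cong refl)
    fix i assume i: "i \<in> {1..Suc m}"
    have "(\<integral>\<^sup>+x. ennreal ((cmod (g (row1_minor (Suc m) i x)))\<^sup>2) \<partial>(\<Pi>\<^sub>M x\<in>?I. complex_gaussian)) =
       (\<integral>\<^sup>+Y. ennreal ((cmod (g Y))\<^sup>2) \<partial>distr (\<Pi>\<^sub>M x\<in>?I. complex_gaussian) (gauss_matrix m) (row1_minor (Suc m) i))"
      by (rule nn_integral_distr[symmetric, OF measurable_row1_minor_PiM[OF i order_refl]]) measurable
    then show "(\<integral>\<^sup>+x. ennreal ((cmod (g (row1_minor (Suc m) i x)))\<^sup>2) \<partial>(\<Pi>\<^sub>M x\<in>?I. complex_gaussian)) =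
       (\<integral>\<^sup>+Y. ennreal ((cmod (g Y))\<^sup>2) \<partial>gauss_matrix m)"
      by (simp only: distr_row1_minor_PiM[OF i order_refl])
  qed
  finally show ?thesis by simp
qed

section \<open>The test\<close>

text \<open>One step of the induction. \<open>G\<close> and \<open>H\<close> stand for the indicator
  conditions at levels m and m+1, \<open>a\<close> for the normalised linearity defect,
  \<open>b\<close> for the normalised L2 error on the minors, and \<open>\<epsilon>\<close> for the
  probability of a bad minor. The integral is bounded through a pointwise majorant.\<close>

lemma error_recursion:
  fixes a b T \<epsilon> :: real
  assumes [measurable]: "f \<in> borel_measurable (gauss_matrix m)"
    and [measurable]: "Measurable.pred (gauss_matrix m) G"
    and pos: "0 < a" "0 < b" "0 \<le> \<epsilon>"
    and lin: "\<And>X. H X \<Longrightarrow> (cmod (f' X - (\<Sum>i = 1..Suc m. X (1, i) * f (row1_minor (Suc m) i X))))\<^sup>2 \<le> a\<^sup>2 * fact (Suc m)"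
    and tail: "\<And>X. H X \<Longrightarrow> (cmod (f' X - Per (Suc m) X))\<^sup>2 \<le> 4 * T\<^sup>2 * fact (Suc m)"
    and prob: "measure (gauss_matrix m) {Y \<in> space (gauss_matrix m). \<not> G Y} \<le> \<epsilon>"
    and IH: "(\<integral>\<^sup>+Y. ennreal (of_bool (G Y) * (cmod (f Y - Per m Y))\<^sup>2) \<partial>gauss_matrix m) \<le> ennreal (b\<^sup>2 * fact m)"
  shows "(\<integral>\<^sup>+X. ennreal (of_bool (H X) * (cmod (f' X - Per (Suc m) X))\<^sup>2) \<partial>gauss_matrix (Suc m))
      \<le> ennreal (((a + b)\<^sup>2 + real (Suc m) * \<epsilon> * (4 * T\<^sup>2)) * fact (Suc m))"
proof -
  let ?k = "Suc m"
  let ?M = "gauss_matrix ?k" and ?N = "gauss_matrix m"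
  interpret N: prob_space ?N by (rule prob_space_gauss_matrix)
  interpret M: prob_space ?M by (rule prob_space_gauss_matrix)
  \<comment> \<open>The error on a minor, cut off to 0 where the minor is bad; its second moment is
    what \<open>IH\<close> controls.\<close>
  define g where "g Y = of_bool (G Y) * (f Y - Per m Y)" for Y
  have g[measurable]: "g \<in> borel_measurable ?N" unfolding g_def by measurable
  define S where "S X = (\<Sum>i = 1..?k. X (1, i) * g (row1_minor ?k i X))" for X
  \<comment> \<open>The number of bad minors: at least 1 as soon as one is bad, and of expectation
    at most (m+1) \<open>\<epsilon>\<close>.\<close>
  define B where "B X = (\<Sum>i = 1..?k. of_bool (\<not> G (row1_minor ?k i X)) :: real)" for X
  note minor = measurable_compose[OF measurable_row1_minor]
  have S[measurable]: "S \<in> borel_measurable ?M"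
    unfolding S_def
    by (intro borel_measurable_sum borel_measurable_times measurable_gauss_entry minor[OF _ g]) auto
  have B[measurable]: "B \<in> borel_measurable ?M"
  proof -
    have "(\<lambda>Y. of_bool (\<not> G Y) :: real) \<in> borel_measurable ?N" by measurable
    from minor[OF _ this] show ?thesis unfolding B_def by (rule borel_measurable_sum)
  qed
  \<comment> \<open>The first two terms cover the case that all minors are good, the last one the
    case of a bad minor.\<close>
  have pointwise: "of_bool (H X) * (cmod (f' X - Per ?k X))\<^sup>2 \<le>
      (a + b) * a * fact ?k + (a + b) / b * (cmod (S X))\<^sup>2 + 4 * T\<^sup>2 * fact ?k * B X" for X
  proof -
    have B0: "0 \<le> B X" unfolding B_def by (intro sum_nonneg) auto
    have nn: "0 \<le> (a + b) * a * fact ?k" "0 \<le> (a + b) / b * (cmod (S X))\<^sup>2" "0 \<le> 4 * T\<^sup>2 * fact ?k * B X"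
      using pos B0 by auto
    show ?thesis
    proof (cases "H X")
      case False then show ?thesis using nn by simp
    next
      case True
      show ?thesis
      proof (cases "\<forall>i\<in>{1..?k}. G (row1_minor ?k i X)")
        case False
        then obtain i where i: "i \<in> {1..?k}" "\<not> G (row1_minor ?k i X)" by blast
        have "1 \<le> B X"
          unfolding B_def using member_le_sum[of i "{1..?k}" "\<lambda>i. of_bool (\<not> G (row1_minor ?k i X)) :: real"] i
          by simp
        then have "4 * T\<^sup>2 * fact ?k * 1 \<le> 4 * T\<^sup>2 * fact ?k * B X"
          by (intro mult_left_mono) auto
        with tail[OF True] nn True show ?thesis by (simp only: of_bool_eq mult_1 mult_1_right)
      next
        case allG: True
        define R where "R = f' X - (\<Sum>i = 1..?k. X (1, i) * f (row1_minor ?k i X))"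
        have "S X = (\<Sum>i = 1..?k. X (1, i) * f (row1_minor ?k i X)) - Per ?k X"
          unfolding S_def Per_Suc_expand sum_subtractf[symmetric]
          by (intro sum.cong refl) (use allG in \<open>simp add: g_def right_diff_distrib\<close>)
        then have "f' X - Per ?k X = R + S X" by (simp add: R_def)
        then have "(cmod (f' X - Per ?k X))\<^sup>2 \<le> (cmod R + cmod (S X))\<^sup>2"
          by (simp add: power_mono norm_triangle_ineq)
        \<comment> \<open>Weights chosen so that integrating yields exactly \<open>(a + b)\<^sup>2\<close>, as Minkowski's inequality would.\<close>
        also have "\<dots> \<le> (a + b) / a * (cmod R)\<^sup>2 + (a + b) / b * (cmod (S X))\<^sup>2"
        proof -
          have "(a + b) / a * (cmod R)\<^sup>2 + (a + b) / b * (cmod (S X))\<^sup>2 - (cmod R + cmod (S X))\<^sup>2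
             = (b * cmod R - a * cmod (S X))\<^sup>2 / (a * b)"
            using pos by (simp add: field_simps power2_eq_square)
          also have "\<dots> \<ge> 0" using pos by simp
          finally show ?thesis by simp
        qed
        also have "\<dots> \<le> (a + b) * a * fact ?k + (a + b) / b * (cmod (S X))\<^sup>2"
        proof (rule add_right_mono)
          have "(a + b) / a * (cmod R)\<^sup>2 \<le> (a + b) / a * (a\<^sup>2 * fact ?k)"
            using lin[OF True] pos unfolding R_def by (intro mult_left_mono) auto
          also have "\<dots> = (a + b) * a * fact ?k"
            using pos by (simp add: field_simps power2_eq_square)
          finally show "(a + b) / a * (cmod R)\<^sup>2 \<le> (a + b) * a * fact ?k" .
        qed
        finally show ?thesis using nn True by (simp only: of_bool_eq mult_1)
      qed
    qed
  qed
  \<comment> \<open>The factor m+1 of the row expansion turns m! into (m+1)!, so the normalised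
    error \<open>b\<close> is unchanged.\<close>
  have S2: "(\<integral>\<^sup>+X. ennreal ((cmod (S X))\<^sup>2) \<partial>?M) \<le> ennreal (b\<^sup>2 * fact ?k)"
  proof -
    have "(\<integral>\<^sup>+X. ennreal ((cmod (S X))\<^sup>2) \<partial>?M) = of_nat ?k * (\<integral>\<^sup>+Y. ennreal ((cmod (g Y))\<^sup>2) \<partial>?N)"
      unfolding S_def by (rule nn_integral_row_expansion[OF g])
    also have "(\<lambda>Y. ennreal ((cmod (g Y))\<^sup>2)) = (\<lambda>Y. ennreal (of_bool (G Y) * (cmod (f Y - Per m Y))\<^sup>2))"
      by (auto simp: g_def fun_eq_iff norm_mult)
    also have "of_nat ?k * (\<integral>\<^sup>+Y. ennreal (of_bool (G Y) * (cmod (f Y - Per m Y))\<^sup>2) \<partial>?N) \<le> of_nat ?k * ennreal (b\<^sup>2 * fact m)"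
      using IH by (rule mult_left_mono) simp
    also have "\<dots> = ennreal (real ?k * (b\<^sup>2 * fact m))"
      by (subst ennreal_mult) (simp_all add: ennreal_of_nat_eq_real_of_nat)
    also have "real ?k * (b\<^sup>2 * fact m) = b\<^sup>2 * fact ?k" by (simp add: algebra_simps)
    finally show ?thesis .
  qed
  have B1: "(\<integral>\<^sup>+X. ennreal (B X) \<partial>?M) \<le> ennreal (real ?k * \<epsilon>)"
  proof -
    have "(\<integral>\<^sup>+X. ennreal (B X) \<partial>?M) = (\<integral>\<^sup>+X. (\<Sum>i = 1..?k. ennreal (of_bool (\<not> G (row1_minor ?k i X)))) \<partial>?M)"
      unfolding B_def by (intro nn_integral_cong sum_ennreal[symmetric]) simp
    also have "\<dots> = (\<Sum>i = 1..?k. \<integral>\<^sup>+X. ennreal (of_bool (\<not> G (row1_minor ?k i X))) \<partial>?M)"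
    proof (rule nn_integral_sum)
      have "(\<lambda>Y. ennreal (of_bool (\<not> G Y))) \<in> borel_measurable ?N" by measurable
      from minor[OF _ this] show "\<And>i. i \<in> {1..?k} \<Longrightarrow> (\<lambda>X. ennreal (of_bool (\<not> G (row1_minor ?k i X)))) \<in>
        borel_measurable ?M" .
    qed
    also have "\<dots> \<le> (\<Sum>i = 1..?k. ennreal \<epsilon>)"
    proof (rule sum_mono)
      fix i assume i: "i \<in> {1..?k}"
      have "(\<integral>\<^sup>+X. ennreal (of_bool (\<not> G (row1_minor ?k i X))) \<partial>?M) =
          (\<integral>\<^sup>+Y. ennreal (of_bool (\<not> G Y)) \<partial>distr ?M ?N (row1_minor ?k i))"
        by (rule nn_integral_distr[symmetric, OF measurable_row1_minor[OF i]]) measurable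
      also have "\<dots> = (\<integral>\<^sup>+Y. indicator {Y \<in> space ?N. \<not> G Y} Y \<partial>?N)"
        unfolding distr_row1_minor[OF i] by (intro nn_integral_cong) (auto simp: indicator_def)
      also have "\<dots> = emeasure ?N {Y \<in> space ?N. \<not> G Y}"
        by (intro nn_integral_indicator) measurable
      also have "\<dots> \<le> ennreal \<epsilon>"
        using prob by (simp add: N.emeasure_eq_measure ennreal_leI)
      finally show "(\<integral>\<^sup>+X. ennreal (of_bool (\<not> G (row1_minor ?k i X))) \<partial>?M) \<le> ennreal \<epsilon>" .
    qed
    also have "\<dots> = ennreal (real ?k * \<epsilon>)"
      by (subst sum_ennreal) (use pos in auto)
    finally show ?thesis .
  qed
  have "(\<integral>\<^sup>+X. ennreal (of_bool (H X) * (cmod (f' X - Per ?k X))\<^sup>2) \<partial>?M) \<le>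
      (\<integral>\<^sup>+X. ennreal ((a + b) * a * fact ?k) + ennreal ((a + b) / b) * ennreal ((cmod (S X))\<^sup>2)
         + ennreal (4 * T\<^sup>2 * fact ?k) * ennreal (B X) \<partial>?M)"
  proof (rule nn_integral_mono)
    fix X
    have "0 \<le> B X" unfolding B_def by (intro sum_nonneg) auto
    then have "ennreal ((a + b) * a * fact ?k) + ennreal ((a + b) / b) * ennreal ((cmod (S X))\<^sup>2)
         + ennreal (4 * T\<^sup>2 * fact ?k) * ennreal (B X) =
       ennreal ((a + b) * a * fact ?k + (a + b) / b * (cmod (S X))\<^sup>2 + 4 * T\<^sup>2 * fact ?k * B X)"
      using pos by (simp only: ennreal_mult[symmetric] ennreal_plus[symmetric] zero_le_power2
        mult_nonneg_nonneg add_nonneg_nonneg divide_nonneg_nonneg less_imp_le fact_ge_zero zero_le_numeral)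
    then show "ennreal (of_bool (H X) * (cmod (f' X - Per ?k X))\<^sup>2) \<le>
       ennreal ((a + b) * a * fact ?k) + ennreal ((a + b) / b) * ennreal ((cmod (S X))\<^sup>2)
         + ennreal (4 * T\<^sup>2 * fact ?k) * ennreal (B X)"
      using pointwise[of X] by (simp only: ennreal_leI)
  qed
  also have "\<dots> = ennreal ((a + b) * a * fact ?k) + ennreal ((a + b) / b) * (\<integral>\<^sup>+X. ennreal ((cmod (S X))\<^sup>2) \<partial>?M)
      + ennreal (4 * T\<^sup>2 * fact ?k) * (\<integral>\<^sup>+X. ennreal (B X) \<partial>?M)"
    by (simp add: nn_integral_add nn_integral_cmult M.emeasure_space_1 del: fact_Suc)
  also have "\<dots> \<le> ennreal ((a + b) * a * fact ?k) + ennreal ((a + b) / b) * ennreal (b\<^sup>2 * fact ?k)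
      + ennreal (4 * T\<^sup>2 * fact ?k) * ennreal (real ?k * \<epsilon>)"
    by (intro add_mono mult_left_mono S2 B1) auto
  also have "\<dots> = ennreal ((a + b) * a * fact ?k + (a + b) / b * (b\<^sup>2 * fact ?k) + 4 * T\<^sup>2 * fact ?k * (real ?k * \<epsilon>))"
    using pos by (simp only: ennreal_mult[symmetric] ennreal_plus[symmetric] zero_le_power2
        mult_nonneg_nonneg add_nonneg_nonneg divide_nonneg_nonneg less_imp_le fact_ge_zero zero_le_numeral of_nat_0_le_iff)
  also have "(a + b) * a * fact ?k + (a + b) / b * (b\<^sup>2 * fact ?k) + 4 * T\<^sup>2 * fact ?k * (real ?k * \<epsilon>) =
     ((a + b)\<^sup>2 + real ?k * \<epsilon> * (4 * T\<^sup>2)) * fact ?k"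
    using pos by (simp add: power2_eq_square field_simps del: fact_Suc of_nat_Suc)
  finally show ?thesis .
qed

text \<open>Markov's inequality for the fourth power. The second moment k! would give only 1/T^2, of
  order \<open>\<delta>\<close>^2 c / n^2, which does not supply the power \<open>\<delta>\<close>^4
  required of the failure probability.\<close>

lemma prob_not_PERM_le:
  assumes T: "0 < T"
  shows "measure (gauss_matrix k) {X \<in> space (gauss_matrix k). \<not> PERM T k X} \<le> real (Suc k) / T ^ 4"
proof -
  interpret prob_space "gauss_matrix k" by (rule prob_space_gauss_matrix)
  obtain B where B: "has_bochner_integral (gauss_matrix k) (\<lambda>X. cmod (Per k X) ^ 4) B"
    "B \<le> real (Suc k) * (fact k)\<^sup>2" by (rule Per_fourth_moment_le)
  have pos: "0 < (T\<^sup>2 * fact k)\<^sup>2" using T by simp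
  have "prob {X \<in> space (gauss_matrix k). \<not> PERM T k X} \<le>
      prob {X \<in> space (gauss_matrix k). (T\<^sup>2 * fact k)\<^sup>2 \<le> cmod (Per k X) ^ 4}"
  proof (rule finite_measure_mono)
    show "{X \<in> space (gauss_matrix k). \<not> PERM T k X} \<subseteq>
       {X \<in> space (gauss_matrix k). (T\<^sup>2 * fact k)\<^sup>2 \<le> cmod (Per k X) ^ 4}"
    proof safe
      fix X assume "\<not> PERM T k X"
      then have "T\<^sup>2 * fact k \<le> (cmod (Per k X))\<^sup>2" by (simp add: PERM_def)
      then have "(T\<^sup>2 * fact k)\<^sup>2 \<le> ((cmod (Per k X))\<^sup>2)\<^sup>2" by (intro power_mono) auto
      then show "(T\<^sup>2 * fact k)\<^sup>2 \<le> cmod (Per k X) ^ 4" by (simp flip: power_mult)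
    qed
  qed measurable
  also have "\<dots> \<le> expectation (\<lambda>X. cmod (Per k X) ^ 4) / (T\<^sup>2 * fact k)\<^sup>2"
    using B(1) pos by (intro integral_Markov_inequality_measure[where A="{}"]) (auto simp: has_bochner_integral_iff)
  also have "\<dots> \<le> real (Suc k) * (fact k)\<^sup>2 / (T\<^sup>2 * fact k)\<^sup>2"
    using B pos by (intro divide_right_mono) (auto simp: has_bochner_integral_iff)
  also have "\<dots> = real (Suc k) / T ^ 4"
    by (simp add: power_mult_distrib flip: power_mult)
  finally show ?thesis .
qed

section \<open>Consequences of a small rejection probability\<close>

context
  fixes n :: nat and \<delta> c :: real and \<O> :: "nat \<Rightarrow> cmatrix \<Rightarrow> complex"
  assumes \<delta>: "0 < \<delta>" "\<delta> \<le> 1" and c: "0 < c" "c \<le> 1"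
    and \<O>: "\<And>k. k \<in> {1..n} \<Longrightarrow> \<O> k \<in> borel_measurable (gauss_matrix k)"
begin

abbreviation "T \<equiv> T_param n \<delta> c"

lemma pred_TAIL: "k \<in> {1..n} \<Longrightarrow> Measurable.pred (gauss_matrix k) (TAIL T \<O> k)"
  using \<O>[of k] unfolding TAIL_def[abs_def] by measurable

lemma pred_PERM: "Measurable.pred (gauss_matrix k) (PERM T k)"
  unfolding PERM_def[abs_def] by measurable

lemma pred_LIN:
  assumes "k \<in> {1..n}"
  shows "Measurable.pred (gauss_matrix k) (LIN n \<delta> \<O> k)"
proof (cases "k = 1")
  case True
  show ?thesis using True \<O>[OF assms] measurable_gauss_entry[of "(1, 1)" 1]
    unfolding LIN_def[abs_def] by simp
next
  case False
  then obtain m where m: "k = Suc m" "m \<in> {1..n}" using assms by (cases k) auto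
  note [measurable] = \<O>[OF assms]
  have [measurable]: "(\<lambda>X. \<Sum>i = 1..k. X (1, i) * \<O> (k - 1) (row1_minor k i X)) \<in> borel_measurable (gauss_matrix k)"
    unfolding m diff_Suc_1
    by (intro borel_measurable_sum borel_measurable_times measurable_gauss_entry
        measurable_compose[OF measurable_row1_minor \<O>[OF m(2)]]) auto
  have "LIN n \<delta> \<O> k = (\<lambda>X. (cmod (\<O> k X - (\<Sum>i = 1..k. X (1, i) * \<O> (k - 1) (row1_minor k i X))))\<^sup>2
      \<le> (real n)\<^sup>2 * \<delta>\<^sup>2 * fact k)"
    using False by (simp add: fun_eq_iff LIN_def)
  then show ?thesis by (simp only:) measurable
qed

lemma pred_ind:
  "k \<in> {1..n} \<Longrightarrow> Measurable.pred (gauss_matrix k) (\<lambda>X. LIN n \<delta> \<O> k X \<and> TAIL T \<O> k X \<and> PERM T k X)"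
  using pred_LIN pred_TAIL pred_PERM by (intro pred_intros_logic)

text \<open>With failure probabilities p and q at level k, independence bounds the acceptance
  probability by ((1-p)(1-q))^d, hence by exp(-d(p+q)). As it exceeds exp(-n), p + q < n/d. Bounding
  the sum at once leaves room for the failures of \<open>PERM\<close>.\<close>

lemma PTest_failure_bound:
  assumes rej: "\<P>(\<omega> in PTest_samples n \<delta> c. PTest n \<delta> c \<O> \<omega> = Reject) < 1 - exp (- real n)"
    and k: "k \<in> {1..n}"
  shows "measure (gauss_matrix k) {X \<in> space (gauss_matrix k). \<not> LIN n \<delta> \<O> k X} +
    measure (gauss_matrix k) {X \<in> space (gauss_matrix k). \<not> TAIL T \<O> k X} \<le> \<delta> ^ 4 * c / (192 * real n)"
proof -
  define d where "d = num_runs n \<delta> c"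
  define J where "J = {Linearity, Tail} \<times> {1..n} \<times> {..<d}"
  define M where "M = (\<lambda>(t::test_kind, k, j::nat). gauss_matrix k)"
  define A where "A = (\<lambda>(t, k, j::nat). {X \<in> space (gauss_matrix k).
      case t of Linearity \<Rightarrow> LIN n \<delta> \<O> k X | Tail \<Rightarrow> TAIL T \<O> k X})"
  have finJ: "finite J" by (simp add: J_def)
  interpret P: product_prob_space M J
    by (intro product_prob_spaceI) (auto simp: M_def prob_space_gauss_matrix split: prod.splits)
  interpret F: finite_product_prob_space M J
    by unfold_locales (rule finJ)
  interpret K: prob_space "gauss_matrix k" by (rule prob_space_gauss_matrix)
  have samples: "PTest_samples n \<delta> c = PiM J M"
    by (simp add: PTest_samples_def J_def M_def d_def)
  have A: "A x \<in> sets (M x)" if "x \<in> J" for x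
  proof -
    obtain t k j where x: "x = (t, k, j)" by (cases x) auto
    then have "k \<in> {1..n}" using that by (auto simp: J_def)
    from pred_LIN[OF this] pred_TAIL[OF this] show ?thesis
      by (cases t) (simp_all add: x A_def M_def pred_def)
  qed
  let ?pL = "K.prob {X \<in> space (gauss_matrix k). LIN n \<delta> \<O> k X}"
  let ?pT = "K.prob {X \<in> space (gauss_matrix k). TAIL T \<O> k X}"
  \<comment> \<open>Acceptance restricts each sample separately, so the event is a box in the
    product space.\<close>
  have accept: "{\<omega> \<in> space (PiM J M). PTest n \<delta> c \<O> \<omega> \<noteq> Reject} = Pi\<^sub>E J A"
  proof (intro set_eqI iffI)
    fix \<omega> assume "\<omega> \<in> {\<omega> \<in> space (PiM J M). PTest n \<delta> c \<O> \<omega> \<noteq> Reject}"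
    then have sp: "\<omega> \<in> Pi\<^sub>E J (\<lambda>x. space (M x))"
      and acc: "\<And>k j. k \<in> {1..n} \<Longrightarrow> j < d \<Longrightarrow> LIN n \<delta> \<O> k (\<omega> (Linearity, k, j)) \<and> TAIL T \<O> k (\<omega> (Tail, k, j))"
      by (auto simp: space_PiM PTest_def LinearityTest_def TailTest_def d_def split: if_splits)
    show "\<omega> \<in> Pi\<^sub>E J A"
    proof (rule PiE_I)
      fix x assume x: "x \<in> J"
      obtain t k j where tkj: "x = (t, k, j)" by (cases x) auto
      have "\<omega> x \<in> space (M x)" using sp x by auto
      with acc[of k j] x show "\<omega> x \<in> A x"
        by (cases t) (auto simp: tkj A_def M_def J_def)
    qed (use sp in auto)
  next
    fix \<omega> assume \<omega>: "\<omega> \<in> Pi\<^sub>E J A"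
    have "\<omega> \<in> Pi\<^sub>E J (\<lambda>x. space (M x))"
      using \<omega> A sets.sets_into_space by (auto simp: PiE_iff) blast
    moreover have "LIN n \<delta> \<O> k (\<omega> (Linearity, k, j)) \<and> TAIL T \<O> k (\<omega> (Tail, k, j))"
      if "k \<in> {1..n}" "j < d" for k j
      using PiE_mem[OF \<omega>, of "(Linearity, k, j)"] PiE_mem[OF \<omega>, of "(Tail, k, j)"] that
      by (auto simp: A_def J_def)
    ultimately show "\<omega> \<in> {\<omega> \<in> space (PiM J M). PTest n \<delta> c \<O> \<omega> \<noteq> Reject}"
      by (auto simp: space_PiM PTest_def LinearityTest_def TailTest_def d_def)
  qed
  have "{\<omega> \<in> space (PiM J M). PTest n \<delta> c \<O> \<omega> = Reject} = space (PiM J M) - Pi\<^sub>E J A"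
    unfolding accept[symmetric] by auto
  moreover have "Pi\<^sub>E J A \<in> sets (PiM J M)"
    using A finJ by (intro sets_PiM_I_finite) auto
  ultimately have "exp (- real n) < measure (PiM J M) (Pi\<^sub>E J A)"
    using rej by (simp add: samples P.P.prob_compl)
  also have "\<dots> = (\<Prod>x\<in>J. measure (M x) (A x))"
    using A by (intro F.prob_times) auto
  \<comment> \<open>The factors of the other levels are at most 1 and are dropped.\<close>
  also have "\<dots> \<le> (\<Prod>x\<in>{Linearity, Tail} \<times> {k} \<times> {..<d}. measure (M x) (A x))"
  proof -
    let ?K = "{Linearity, Tail} \<times> {k} \<times> {..<d}"
    have "?K \<subseteq> J" using k by (auto simp: J_def)
    then have "(\<Prod>x\<in>J. measure (M x) (A x)) = (\<Prod>x\<in>J - ?K. measure (M x) (A x)) * (\<Prod>x\<in>?K. measure (M x) (A x))"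
      using finJ by (rule prod.subset_diff)
    also have "\<dots> \<le> 1 * (\<Prod>x\<in>?K. measure (M x) (A x))"
      by (intro mult_right_mono prod_le_1 prod_nonneg) (auto simp: P.M.prob_le_1)
    finally show ?thesis by simp
  qed
  also have "\<dots> = (\<Prod>t\<in>{Linearity, Tail}. \<Prod>j<d. measure (M (t, k, j)) (A (t, k, j)))"
    by (subst prod.cartesian_product,
      rule prod.reindex_bij_witness[of _ "\<lambda>(t, j). (t, k, j)" "\<lambda>(t, _, j). (t, j)"]) auto
  also have "\<dots> = (?pL * ?pT) ^ d"
    by (simp add: M_def A_def power_mult_distrib)
  finally have 1: "exp (- real n) < (?pL * ?pT) ^ d" .
  define p where "p = K.prob {X \<in> space (gauss_matrix k). \<not> LIN n \<delta> \<O> k X}"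
  define q where "q = K.prob {X \<in> space (gauss_matrix k). \<not> TAIL T \<O> k X}"
  have pL: "?pL = 1 - p"
    unfolding p_def using K.prob_neg[of "LIN n \<delta> \<O> k"] pred_LIN[OF k] by (simp add: pred_def)
  have pT: "?pT = 1 - q"
    unfolding q_def using K.prob_neg[of "TAIL T \<O> k"] pred_TAIL[OF k] by (simp add: pred_def)
  have "?pL \<le> exp (- p)" "?pT \<le> exp (- q)"
    using exp_ge_add_one_self[of "- p"] exp_ge_add_one_self[of "- q"] by (simp_all add: pL pT)
  then have "(?pL * ?pT) ^ d \<le> (exp (- p) * exp (- q)) ^ d"
    by (intro power_mono mult_mono) auto
  also have "\<dots> = exp (- (real d * (p + q)))"
    by (simp add: exp_add[symmetric] exp_of_nat_mult[symmetric] algebra_simps)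
  finally have "exp (- real n) < exp (- (real d * (p + q)))" using 1 by (rule less_le_trans[rotated])
  then have dn: "real d * (p + q) < real n" by simp
  have n: "0 < real n" using k by simp
  \<comment> \<open>Rounding the number of runs up makes \<open>d\<close> at least the real
    parameter, the direction in which the bound survives.\<close>
  have dp: "0 < d_param n \<delta> c" "d_param n \<delta> c \<le> real d"
    using n \<delta> c by (auto simp: d_param_def d_def num_runs_def of_nat_ceiling)
  have "d_param n \<delta> c * (p + q) \<le> real d * (p + q)"
    using dp by (intro mult_right_mono) (auto simp: p_def q_def)
  with dn have "d_param n \<delta> c * (p + q) \<le> real n" by simp
  then have "p + q \<le> real n / d_param n \<delta> c"
    using dp by (simp add: field_simps)
  also have "\<dots> = \<delta> ^ 4 * c / (192 * real n)"
    using n \<delta> c by (simp add: d_param_def field_simps power2_eq_square)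
  finally show ?thesis by (simp add: p_def q_def)
qed

text \<open>A union bound. In units of \<open>\<delta>\<close>^4 c / n, the two tests together cost
  1/192 and the permanent 1/128; the sum 5/384 is below 1/64 = 6/384.\<close>

lemma prob_not_ind_le:
  assumes rej: "\<P>(\<omega> in PTest_samples n \<delta> c. PTest n \<delta> c \<O> \<omega> = Reject) < 1 - exp (- real n)"
    and k: "k \<in> {1..n}"
  shows "measure (gauss_matrix k) {X \<in> space (gauss_matrix k). \<not> (LIN n \<delta> \<O> k X \<and> TAIL T \<O> k X \<and> PERM T k X)}
     \<le> \<delta> ^ 4 * c / (64 * real n)"
proof -
  interpret prob_space "gauss_matrix k" by (rule prob_space_gauss_matrix)
  have n: "1 \<le> real n" using k by simp
  have T: "0 < T" using n \<delta> c by (simp add: T_param_def)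
  let ?N = "\<lambda>Q. {X \<in> space (gauss_matrix k). \<not> Q X}"
  have ev: "?N (LIN n \<delta> \<O> k) \<in> events" "?N (TAIL T \<O> k) \<in> events" "?N (PERM T k) \<in> events"
    using pred_LIN[OF k] pred_TAIL[OF k] pred_PERM[of k] by (simp_all add: pred_def sets.sets_Collect_neg)
  have "prob (?N (\<lambda>X. LIN n \<delta> \<O> k X \<and> TAIL T \<O> k X \<and> PERM T k X)) =
      prob ((?N (LIN n \<delta> \<O> k) \<union> ?N (TAIL T \<O> k)) \<union> ?N (PERM T k))"
    by (rule arg_cong[where f=prob]) auto
  also have "\<dots> \<le> (prob (?N (LIN n \<delta> \<O> k)) + prob (?N (TAIL T \<O> k))) + prob (?N (PERM T k))"
    using ev by (intro order_trans[OF measure_Un_le] add_mono measure_Un_le) auto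
  also have "\<dots> \<le> \<delta> ^ 4 * c / (192 * real n) + real (Suc k) / T ^ 4"
    by (intro add_mono PTest_failure_bound prob_not_PERM_le rej k T)
  also have "real (Suc k) / T ^ 4 \<le> \<delta> ^ 4 * c / (128 * real n)"
  proof -
    have T4: "T ^ 4 = 256 * real n ^ 4 / (\<delta> ^ 4 * c\<^sup>2)"
    proof -
      have "sqrt c ^ 4 = (sqrt c ^ 2) ^ 2" by (simp flip: power_mult)
      then show ?thesis using c by (simp add: T_param_def power_divide power_mult_distrib)
    qed
    \<comment> \<open>Here k + 1 is at most 2n, because 1 \<le> k \<le> n. The rest follows from c
      \<le> 1 and n \<le> n^3.\<close>
    have "real (Suc k) / T ^ 4 \<le> (2 * real n) / T ^ 4"
      using k by (intro divide_right_mono) auto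
    also have "\<dots> = \<delta> ^ 4 * c * (c * (2 * real n / (256 * real n ^ 4)))"
      using n \<delta> c by (simp add: T4 power2_eq_square)
    also have "\<dots> \<le> \<delta> ^ 4 * c * (1 * (1 / (128 * real n)))"
    proof (intro mult_left_mono mult_mono)
      have "2 * real n / (256 * real n ^ 4) = 1 / (128 * real n ^ 3)"
        using n by (simp add: field_simps eval_nat_numeral)
      also have "\<dots> \<le> 1 / (128 * real n ^ 1)"
        using n by (intro divide_left_mono mult_left_mono power_increasing) auto
      finally show "2 * real n / (256 * real n ^ 4) \<le> 1 / (128 * real n)" by simp
    qed (use \<delta> c in auto)
    finally show ?thesis by simp
  qed
  also have "\<delta> ^ 4 * c / (192 * real n) + \<delta> ^ 4 * c / (128 * real n) \<le> \<delta> ^ 4 * c / (64 * real n)"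
    using n \<delta> c by (simp add: field_simps)
  finally show ?thesis by simp
qed

text \<open>Induction on k with normalised L2 error 2 n k \<open>\<delta>\<close>. A level adds n
  \<open>\<delta>\<close> through the linearity defect, and the bad minors add at most (n
  \<open>\<delta>\<close>)^2 to the square; the factor 2 leaves room for the latter. At level 1,
  linearity already compares the oracle with the permanent.\<close>

lemma ind_error_le:
  assumes rej: "\<P>(\<omega> in PTest_samples n \<delta> c. PTest n \<delta> c \<O> \<omega> = Reject) < 1 - exp (- real n)"
    and k: "1 \<le> k" "k \<le> n"
  shows "(\<integral>\<^sup>+X. ennreal (ind n \<delta> c \<O> k X * (cmod (\<O> k X - Per k X))\<^sup>2) \<partial>gauss_matrix k)
     \<le> ennreal ((2 * real n * real k * \<delta>)\<^sup>2 * fact k)"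
  using k
proof (induction k rule: dec_induct)
  case base
  interpret prob_space "gauss_matrix 1" by (rule prob_space_gauss_matrix)
  have Per1: "Per 1 X = X (1, 1)" for X
    using Per_Suc_expand[of 0 X] by (simp add: Per_def)
  have "(\<integral>\<^sup>+X. ennreal (ind n \<delta> c \<O> 1 X * (cmod (\<O> 1 X - Per 1 X))\<^sup>2) \<partial>gauss_matrix 1) \<le>
     (\<integral>\<^sup>+X. ennreal ((real n)\<^sup>2 * \<delta>\<^sup>2) \<partial>gauss_matrix 1)"
    by (intro nn_integral_mono ennreal_leI) (simp add: ind_def LIN_def Per1[simplified])
  also have "\<dots> \<le> ennreal ((2 * real n * real 1 * \<delta>)\<^sup>2 * fact 1)"
    using emeasure_space_1 by (auto intro!: ennreal_leI simp: power_mult_distrib)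
  finally show ?case by simp
next
  case (step m)
  have n: "1 \<le> real n" and m: "m \<in> {1..n}" "Suc m \<in> {1..n}" using step by auto
  define \<epsilon> where "\<epsilon> = \<delta> ^ 4 * c / (64 * real n)"
  have "(\<integral>\<^sup>+X. ennreal (ind n \<delta> c \<O> (Suc m) X * (cmod (\<O> (Suc m) X - Per (Suc m) X))\<^sup>2) \<partial>gauss_matrix (Suc m))
     \<le> ennreal (((real n * \<delta> + 2 * real n * real m * \<delta>)\<^sup>2 + real (Suc m) * \<epsilon> * (4 * T\<^sup>2)) * fact (Suc m))"
    unfolding ind_def
  proof (rule error_recursion[OF \<O>[OF m(1)] pred_ind[OF m(1)]])
    show "0 < real n * \<delta>" "0 < 2 * real n * real m * \<delta>" "0 \<le> \<epsilon>"
      using n m \<delta> c by (auto simp: \<epsilon>_def)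
    show "measure (gauss_matrix m) {Y \<in> space (gauss_matrix m). \<not> (LIN n \<delta> \<O> m Y \<and> TAIL T \<O> m Y \<and> PERM T m Y)} \<le> \<epsilon>"
      unfolding \<epsilon>_def by (rule prob_not_ind_le[OF rej m(1)])
    show "(\<integral>\<^sup>+Y. ennreal (of_bool (LIN n \<delta> \<O> m Y \<and> TAIL T \<O> m Y \<and> PERM T m Y) * (cmod (\<O> m Y - Per m Y))\<^sup>2) \<partial>gauss_matrix m)
        \<le> ennreal ((2 * real n * real m * \<delta>)\<^sup>2 * fact m)"
      using step.IH step.prems unfolding ind_def by simp
    fix X assume H: "LIN n \<delta> \<O> (Suc m) X \<and> TAIL T \<O> (Suc m) X \<and> PERM T (Suc m) X"
    show "(cmod (\<O> (Suc m) X - (\<Sum>i = 1..Suc m. X (1, i) * \<O> m (row1_minor (Suc m) i X))))\<^sup>2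
       \<le> (real n * \<delta>)\<^sup>2 * fact (Suc m)"
      using H m unfolding LIN_def by (simp add: power_mult_distrib)
    have "(cmod (\<O> (Suc m) X - Per (Suc m) X))\<^sup>2 \<le> (cmod (\<O> (Suc m) X) + cmod (Per (Suc m) X))\<^sup>2"
      by (intro power_mono norm_triangle_ineq4) simp
    also have "\<dots> \<le> 2 * (cmod (\<O> (Suc m) X))\<^sup>2 + 2 * (cmod (Per (Suc m) X))\<^sup>2"
      using sum_squares_bound[of "cmod (\<O> (Suc m) X)" "cmod (Per (Suc m) X)"] by (simp add: power2_sum)
    also have "\<dots> \<le> 2 * (T\<^sup>2 * fact (Suc m)) + 2 * (T\<^sup>2 * fact (Suc m))"
      using H unfolding TAIL_def PERM_def by (intro add_mono mult_left_mono) auto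
    finally show "(cmod (\<O> (Suc m) X - Per (Suc m) X))\<^sup>2 \<le> 4 * T\<^sup>2 * fact (Suc m)"
      by (simp only: mult.assoc)
  qed
  also have "\<dots> \<le> ennreal ((2 * real n * real (Suc m) * \<delta>)\<^sup>2 * fact (Suc m))"
  proof (intro ennreal_leI mult_right_mono)
    \<comment> \<open>The product of \<open>\<delta>\<close>^4 c / (64 n) and 64 n^2 /
      (\<open>\<delta>\<close>^2 c): the choice of \<open>T\<close> cancels \<open>c\<close> and two
      powers of \<open>\<delta>\<close>.\<close>
    have "\<epsilon> * (4 * T\<^sup>2) = real n * \<delta>\<^sup>2"
      using n \<delta> c by (simp add: \<epsilon>_def T_param_def power_divide power_mult_distrib field_simps eval_nat_numeral)
    then have "real (Suc m) * \<epsilon> * (4 * T\<^sup>2) = real (Suc m) * (real n * \<delta>\<^sup>2)"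
      by (simp only: mult.assoc)
    also have "\<dots> \<le> real n * (real n * \<delta>\<^sup>2)"
      using m by (intro mult_right_mono) auto
    finally have "(real n * \<delta> + 2 * real n * real m * \<delta>)\<^sup>2 + real (Suc m) * \<epsilon> * (4 * T\<^sup>2) \<le>
       (real n * \<delta>)\<^sup>2 * ((2 * real m + 1)\<^sup>2 + 1)"
      by (simp add: power2_eq_square algebra_simps)
    \<comment> \<open>(2m+2)^2 exceeds (2m+1)^2 by 4m+3, which absorbs the 1 due to bad
      minors.\<close>
    also have "\<dots> \<le> (real n * \<delta>)\<^sup>2 * (2 * real m + 2)\<^sup>2"
      by (rule mult_left_mono[OF _ zero_le_power2]) (simp add: power2_eq_square algebra_simps)
    also have "\<dots> = (2 * real n * real (Suc m) * \<delta>)\<^sup>2"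
      by (simp add: power2_eq_square algebra_simps)
    finally show "(real n * \<delta> + 2 * real n * real m * \<delta>)\<^sup>2 + real (Suc m) * \<epsilon> * (4 * T\<^sup>2) \<le>
        (2 * real n * real (Suc m) * \<delta>)\<^sup>2" .
  qed simp
  finally show ?case .
qed

lemma integral_ind_ge:
  assumes rej: "\<P>(\<omega> in PTest_samples n \<delta> c. PTest n \<delta> c \<O> \<omega> = Reject) < 1 - exp (- real n)"
    and k: "k \<in> {1..n}"
  shows "(\<integral>X. ind n \<delta> c \<O> k X \<partial>gauss_matrix k) \<ge> 1 - \<delta> ^ 4 * c / (64 * real n)"
proof -
  interpret prob_space "gauss_matrix k" by (rule prob_space_gauss_matrix)
  let ?Q = "\<lambda>X. LIN n \<delta> \<O> k X \<and> TAIL T \<O> k X \<and> PERM T k X"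
  have "(\<integral>X. ind n \<delta> c \<O> k X \<partial>gauss_matrix k) = (\<integral>X. indicator {X \<in> space (gauss_matrix k). ?Q X} X \<partial>gauss_matrix k)"
    by (intro Bochner_Integration.integral_cong) (auto simp: ind_def indicator_def)
  also have "\<dots> = prob {X \<in> space (gauss_matrix k). ?Q X}"
    by (simp add: Int_absorb2 subset_eq)
  also have "\<dots> = 1 - prob {X \<in> space (gauss_matrix k). \<not> ?Q X}"
    using prob_neg[of ?Q] pred_ind[OF k] by (simp add: pred_def)
  finally show ?thesis using prob_not_ind_le[OF rej k] by simp
qed

end

theorem mainTheorem4:
  "\<exists>C::real. C > 0 \<and>
    (\<forall>(n::nat) (\<delta>::real) (c::real) (\<O> :: nat \<Rightarrow> cmatrix \<Rightarrow> complex).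
      0 < \<delta> \<longrightarrow> \<delta> \<le> 1 \<longrightarrow> 0 < c \<longrightarrow> c \<le> 1 \<longrightarrow>
      real n \<ge> C * sqrt (ln (1 / (\<delta> * c))) \<longrightarrow>
      (\<forall>k\<in>{1..n}. \<O> k \<in> borel_measurable (gauss_matrix k)) \<longrightarrow>
      (\<forall>k\<in>{1..n}.
          (\<integral>X. ind n \<delta> c \<O> k X \<partial>gauss_matrix k) \<ge> 1 - \<delta> ^ 4 * c / (64 * real n) \<and>
          (\<integral>X. ind n \<delta> c \<O> k X * (cmod (\<O> k X - Per k X))\<^sup>2 \<partial>gauss_matrix k)
            \<le> (2 * real n * real k * \<delta>)\<^sup>2 * fact k) \<or>
      \<P>(\<omega> in PTest_samples n \<delta> c. PTest n \<delta> c \<O> \<omega> = Reject) \<ge> 1 - exp (- real n))"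
proof (intro exI[of _ 1] conjI allI impI)
  fix n :: nat and \<delta> c :: real and \<O> :: "nat \<Rightarrow> cmatrix \<Rightarrow> complex"
  assume a: "0 < \<delta>" "\<delta> \<le> 1" "0 < c" "c \<le> 1"
    and "\<forall>k\<in>{1..n}. \<O> k \<in> borel_measurable (gauss_matrix k)"
  then have \<O>: "\<And>k. k \<in> {1..n} \<Longrightarrow> \<O> k \<in> borel_measurable (gauss_matrix k)" by blast
  show "(\<forall>k\<in>{1..n}.
          (\<integral>X. ind n \<delta> c \<O> k X \<partial>gauss_matrix k) \<ge> 1 - \<delta> ^ 4 * c / (64 * real n) \<and>
          (\<integral>X. ind n \<delta> c \<O> k X * (cmod (\<O> k X - Per k X))\<^sup>2 \<partial>gauss_matrix k)
            \<le> (2 * real n * real k * \<delta>)\<^sup>2 * fact k) \<or>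
      \<P>(\<omega> in PTest_samples n \<delta> c. PTest n \<delta> c \<O> \<omega> = Reject) \<ge> 1 - exp (- real n)"
  proof (rule disjCI, intro ballI conjI)
    assume "\<not> 1 - exp (- real n) \<le> \<P>(\<omega> in PTest_samples n \<delta> c. PTest n \<delta> c \<O> \<omega> = Reject)"
    then have rej: "\<P>(\<omega> in PTest_samples n \<delta> c. PTest n \<delta> c \<O> \<omega> = Reject) < 1 - exp (- real n)"
      by simp
    fix k assume k: "k \<in> {1..n}"
    show "(\<integral>X. ind n \<delta> c \<O> k X \<partial>gauss_matrix k) \<ge> 1 - \<delta> ^ 4 * c / (64 * real n)"
      by (rule integral_ind_ge[OF a \<O> rej k])
    \<comment> \<open>The bound was proved for the nonnegative extended integral; since it is finite
      and nonnegative, it passes to the Bochner integral.\<close>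
    show "(\<integral>X. ind n \<delta> c \<O> k X * (cmod (\<O> k X - Per k X))\<^sup>2 \<partial>gauss_matrix k)
            \<le> (2 * real n * real k * \<delta>)\<^sup>2 * fact k"
      using k by (intro integral_real_bounded ind_error_le[OF a \<O> rej]) auto
  qed
qed simp

end
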